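(* Assume that the scalars $M$ and $A_0$ in step 0 of NC-FISTA are such that $$\frac{M}{M-\bar M}=\mathcal{O}(1),\qquad A_0=\Theta(1).$$ Then NC-FISTA outputs a $\hat\rho$-approximate solution $(\hat y,\hat v)$ of $\min_{z\in\mathbb{R}^n}\{f(z)+h(z)\}$, i.e. a pair with $\hat v\in\nabla f(\hat y)+\partial h(\hat y)$ and $\|\hat v\|\le\hat\rho$, in at most $$\mathcal{O}\left(\left(\frac{M(\phi(y_0)-\phi_* )+M^2d_0^2}{\hat\rho^2}\right)^{1/3}+\left(\frac{MmD_h^2}{\hat\rho^2}\right)^{1/2}+\frac{M\bar mD_h^2}{\hat\rho^2}+1\right)$$ iterations.
   Context: Problem: $\phi_*:=\min\{\phi(z):=f(z)+h(z): z\in\mathbb{R}^n\}$, where $f$ is real-valued. Standing assumptions: (A1) $h:\mathbb{R}^n\to(-\infty,\infty]$ is proper, lower semicontinuous and convex; (A2) $\mathrm{dom}\,h$ is bounded; (A3) $f$ is differentiable on a closed convex set $\Omega\supseteq\mathrm{dom}\,h$ and there is $M>0$ with $\|\nabla f(z')-\nabla f(z)\|\le M\|z'-z\|$ for all $z,z'\in\Omega$; (A4) $f$ is nonconvex on $\mathrm{dom}\,h$ and there is $m>0$ with $-\frac m2\|z'-z\|^2\le f(z')-f(z)-\langle\nabla f(z),z'-z\rangle$ for all $z,z'\in\Omega$. $\bar M$ (resp. $\bar m$) denotes the smallest $M$ (resp. $m$) for which the inequality in (A3) (resp. (A4)) holds for all $z,z'\in\Omega$; one has $\bar M\ge\bar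 m>0$. $D_h:=\sup\{\|u'-u\|:u,u'\in\mathrm{dom}\,h\}<\infty$. $Z^*$ is the (nonempty compact) set of optimal solutions and $d_0:=\inf_{z^*\in Z^*}\|z^*-y_0\|$. Notation: $\ell_f(u;\tilde x):=f(\tilde x)+\langle\nabla f(\tilde x),u-\tilde x\rangle$; $P_\Omega$ is the orthogonal projection onto $\Omega$; $\partial h$ is the convex subdifferential. NC-FISTA: Step 0. Input: $y_0\in\mathrm{dom}\,h$, a pair $(M,m)\in\mathbb{R}^2_{++}$ with $M\ge m\ge\bar m$ and $M>\bar M$, a scalar $A_0>0$, a tolerance $\hat\rho>0$. Set $x_0=y_0$, $\lambda=1/M$, $k=0$, $\kappa_0=\frac{1+\sqrt{1+4A_0}}{\sqrt{1+4A_0}-1}$. Step 1. $a_k=\frac{1+\sqrt{1+4A_k}}{2}$, $A_{k+1}=A_k+a_k$. Step 2. $\tilde x_k=\frac{A_k}{A_{k+1}}y_k+\frac{a_k}{A_{k+1}}x_k$; $y_{k+1}=\mathrm{argmin}_u\{\ell_f(u;\tilde x_k)+h(u)+\frac12(\frac1\lambda+\frac{\kappa_0m}{a_k})\|u-\tilde x_k\|^2\}$; $\hat x_{k+1}=\frac{(a_k+\kappa_0m\lambda)y_{k+1}-(a_k-1)y_k}{\kappa_0m\lambda+1}$; $x_{k+1}=P_\Omega(\hat x_{k+1})$. Step 3. $v_{k+1}=(\frac1\lambda+\frac{\kappa_0m}{a_k})(\tilde x_k-y_{k+1})+\nabla f(y_{k+1})-\nabla f(\tilde x_k)$. If $\|v_{k+1}\|\le\hat\rho$,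 output $(\hat y,\hat v)=(y_{k+1},v_{k+1})$ and stop; otherwise set $k\leftarrow k+1$ and go to Step 1. In the claim, $M,m,A_0,\hat\rho,y_0$ are the inputs of Step 0. The constant implied by the final $\mathcal{O}(\cdot)$ depends only on the constants implied in the hypotheses $M/(M-\bar M)=\mathcal{O}(1)$ and $A_0=\Theta(1)$ (the latter meaning that $A_0$ is bounded above and below by positive absolute constants). *)

theory Defs
  imports "HOL-Analysis.Analysis"
begin

text \<open>
  The constant in the complexity bound must not depend on the dimension, so the dimension has to be
  quantified inside the statement, after the constant has been chosen; a type-indexed
  Euclidean space does not allow this.  We therefore realise all the spaces
  \<open>\<real>\<^sup>n\<close> inside one type: finitely supported real sequences with the standard inner
  product, where \<open>\<real>\<^sup>n\<close> is the set \<open>Rn n\<close> of sequences supported on the first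
  \<open>n\<close> coordinates, with the induced Euclidean norm and topology.
\<close>

typedef evec = "{x :: nat \<Rightarrow> real. finite {i. x i \<noteq> 0}}"
  morphisms coord Abs_evec
  by (rule exI[of _ "\<lambda>_. 0"]) simp

setup_lifting type_definition_evec

lemma finite_support: "finite {i. coord x i \<noteq> 0}"
  using coord[of x] by simp

lemma evec_eqI: "(\<And>i. coord x i = coord y i) \<Longrightarrow> x = y"
  by (metis coord_inject ext)

instantiation evec :: real_vector
begin

lift_definition zero_evec :: evec is "\<lambda>_. 0" by simp

lift_definition plus_evec :: "evec \<Rightarrow> evec \<Rightarrow> evec" is "\<lambda>x y i. x i + y i"
proof -
  fix x y :: "nat \<Rightarrow> real"
  assume "finite {i. x i \<noteq> 0}" "finite {i. y i \<noteq> 0}"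
  then have "finite ({i. x i \<noteq> 0} \<union> {i. y i \<noteq> 0})"
    by simp
  then show "finite {i. x i + y i \<noteq> 0}"
    by (rule finite_subset[rotated]) auto
qed

lift_definition minus_evec :: "evec \<Rightarrow> evec \<Rightarrow> evec" is "\<lambda>x y i. x i - y i"
proof -
  fix x y :: "nat \<Rightarrow> real"
  assume "finite {i. x i \<noteq> 0}" "finite {i. y i \<noteq> 0}"
  then have "finite ({i. x i \<noteq> 0} \<union> {i. y i \<noteq> 0})"
    by simp
  then show "finite {i. x i - y i \<noteq> 0}"
    by (rule finite_subset[rotated]) auto
qed

lift_definition uminus_evec :: "evec \<Rightarrow> evec" is "\<lambda>x i. - x i" by simp

lift_definition scaleR_evec :: "real \<Rightarrow> evec \<Rightarrow> evec" is "\<lambda>c x i. c * x i"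
  by (erule finite_subset[rotated]) auto

instance
  by standard
    (rule evec_eqI, simp add: zero_evec.rep_eq plus_evec.rep_eq minus_evec.rep_eq
      uminus_evec.rep_eq scaleR_evec.rep_eq algebra_simps)+

end

instantiation evec :: real_inner
begin

definition inner_evec :: "evec \<Rightarrow> evec \<Rightarrow> real" where
  "inner_evec x y = (\<Sum>i | coord x i \<noteq> 0. coord x i * coord y i)"

definition norm_evec :: "evec \<Rightarrow> real" where
  "norm_evec x = sqrt (inner x x)"

definition dist_evec :: "evec \<Rightarrow> evec \<Rightarrow> real" where
  "dist_evec x y = norm (x - y)"

definition sgn_evec :: "evec \<Rightarrow> evec" where
  "sgn_evec x = x /\<^sub>R norm x"

definition uniformity_evec :: "(evec \<times> evec) filter" where
  "uniformity_evec = (INF e\<in>{0<..}. principal {(x, y). dist x y < e})"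

definition open_evec :: "evec set \<Rightarrow> bool" where
  "open_evec U \<longleftrightarrow> (\<forall>x\<in>U. \<forall>\<^sub>F (x', y) in uniformity. x' = x \<longrightarrow> y \<in> U)"

lemma inner_evec_superset:
  assumes "finite S" "{i. coord x i \<noteq> 0} \<subseteq> S"
  shows "inner x y = (\<Sum>i\<in>S. coord x i * coord y i)"
  unfolding inner_evec_def by (rule sum.mono_neutral_left) (use assms in auto)

instance
proof
  fix x y z :: evec and r :: real
  let ?S = "{i. coord x i \<noteq> 0} \<union> {i. coord y i \<noteq> 0}"
  have S: "finite ?S" by (simp add: finite_support)
  show "inner x y = inner y x"
    using inner_evec_superset[OF S, of x y] inner_evec_superset[OF S, of y x]
    by (simp add: mult.commute)
  have "{i. coord (x + y) i \<noteq> 0} \<subseteq> ?S"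
    by (auto simp: plus_evec.rep_eq)
  then show "inner (x + y) z = inner x z + inner y z"
    using inner_evec_superset[OF S, of x z] inner_evec_superset[OF S, of y z]
      inner_evec_superset[OF S, of "x + y" z]
    by (simp add: plus_evec.rep_eq algebra_simps sum.distrib)
  have "{i. coord (r *\<^sub>R x) i \<noteq> 0} \<subseteq> {i. coord x i \<noteq> 0}"
    by (auto simp: scaleR_evec.rep_eq)
  then show "inner (r *\<^sub>R x) y = r * inner x y"
    using inner_evec_superset[OF finite_support, of "r *\<^sub>R x" x y]
    by (simp add: inner_evec_def scaleR_evec.rep_eq sum_distrib_left mult.assoc)
  show "0 \<le> inner x x"
    unfolding inner_evec_def by (rule sum_nonneg) simp
  show "inner x x = 0 \<longleftrightarrow> x = 0"
  proof
    assume "inner x x = 0"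
    then have "\<forall>i\<in>{i. coord x i \<noteq> 0}. coord x i * coord x i = 0"
      unfolding inner_evec_def by (subst (asm) sum_nonneg_eq_0_iff) (auto simp: finite_support)
    then show "x = 0"
      by (intro evec_eqI) (auto simp: zero_evec.rep_eq)
  qed (simp add: inner_evec_def zero_evec.rep_eq)
qed (simp_all add: norm_evec_def dist_evec_def sgn_evec_def uniformity_evec_def open_evec_def)

end

definition Rn :: "nat \<Rightarrow> evec set" where
  "Rn n = {x. \<forall>i\<ge>n. coord x i = 0}"


section \<open>The composite problem\<close>

text \<open>Functions on \<open>\<real>\<^sup>n\<close> are functions on \<open>evec\<close> whose values outside
  \<open>Rn n\<close> are never used.\<close>

definition eff_dom :: "nat \<Rightarrow> (evec \<Rightarrow> ereal) \<Rightarrow> evec set" where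
  "eff_dom n h = {z \<in> Rn n. h z < \<infinity>}"

definition proper :: "nat \<Rightarrow> (evec \<Rightarrow> ereal) \<Rightarrow> bool" where
  "proper n h \<longleftrightarrow> (\<forall>z\<in>Rn n. h z > -\<infinity>) \<and> eff_dom n h \<noteq> {}"

definition lower_semicontinuous :: "nat \<Rightarrow> (evec \<Rightarrow> ereal) \<Rightarrow> bool" where
  "lower_semicontinuous n h \<longleftrightarrow> (\<forall>z\<in>Rn n. h z \<le> Liminf (at z within Rn n) h)"

definition convex_ext :: "nat \<Rightarrow> (evec \<Rightarrow> ereal) \<Rightarrow> bool" where
  "convex_ext n h \<longleftrightarrow> (\<forall>x\<in>Rn n. \<forall>y\<in>Rn n. \<forall>u\<ge>0. \<forall>v\<ge>0. u + v = 1 \<longrightarrow>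
     h (u *\<^sub>R x + v *\<^sub>R y) \<le> ereal u * h x + ereal v * h y)"

text \<open>The gradient is the one in \<open>\<real>\<^sup>n\<close>, also at boundary points of \<open>\<Omega>\<close>.\<close>

definition grad :: "nat \<Rightarrow> (evec \<Rightarrow> real) \<Rightarrow> evec \<Rightarrow> evec" where
  "grad n f z = (THE g. g \<in> Rn n \<and> (f has_derivative (\<lambda>w. inner w g)) (at z within Rn n))"

definition subdifferential :: "nat \<Rightarrow> (evec \<Rightarrow> ereal) \<Rightarrow> evec \<Rightarrow> evec set" where
  "subdifferential n h z = {g \<in> Rn n. \<forall>u\<in>Rn n. h u \<ge> h z + ereal (inner g (u - z))}"

definition linearization :: "nat \<Rightarrow> (evec \<Rightarrow> real) \<Rightarrow> evec \<Rightarrow> evec \<Rightarrow> real" where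
  "linearization n f u x = f x + inner (grad n f x) (u - x)"

definition lower_curvature :: "nat \<Rightarrow> (evec \<Rightarrow> real) \<Rightarrow> evec set \<Rightarrow> real \<Rightarrow> bool" where
  "lower_curvature n f \<Omega> m \<longleftrightarrow>
     (\<forall>z\<in>\<Omega>. \<forall>z'\<in>\<Omega>. - (m / 2) * (norm (z' - z))\<^sup>2 \<le> f z' - linearization n f z' z)"

definition assumption_A1 :: "nat \<Rightarrow> (evec \<Rightarrow> ereal) \<Rightarrow> bool" where
  "assumption_A1 n h \<longleftrightarrow> proper n h \<and> lower_semicontinuous n h \<and> convex_ext n h"

definition assumption_A2 :: "nat \<Rightarrow> (evec \<Rightarrow> ereal) \<Rightarrow> bool" where
  "assumption_A2 n h \<longleftrightarrow> bounded (eff_dom n h)"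

definition assumption_A3 ::
    "nat \<Rightarrow> (evec \<Rightarrow> real) \<Rightarrow> (evec \<Rightarrow> ereal) \<Rightarrow> evec set \<Rightarrow> bool" where
  "assumption_A3 n f h \<Omega> \<longleftrightarrow>
     closed \<Omega> \<and> convex \<Omega> \<and> eff_dom n h \<subseteq> \<Omega> \<and> \<Omega> \<subseteq> Rn n \<and>
     (\<forall>z\<in>\<Omega>. f differentiable (at z within Rn n)) \<and>
     (\<exists>M>0. M-lipschitz_on \<Omega> (grad n f))"

definition assumption_A4 ::
    "nat \<Rightarrow> (evec \<Rightarrow> real) \<Rightarrow> (evec \<Rightarrow> ereal) \<Rightarrow> evec set \<Rightarrow> bool" where
  "assumption_A4 n f h \<Omega> \<longleftrightarrow>
     \<not> convex_on (eff_dom n h) f \<and> (\<exists>m>0. lower_curvature n f \<Omega> m)"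

definition M_bar :: "nat \<Rightarrow> (evec \<Rightarrow> real) \<Rightarrow> evec set \<Rightarrow> real" where
  "M_bar n f \<Omega> = (LEAST M. M-lipschitz_on \<Omega> (grad n f))"

definition m_bar :: "nat \<Rightarrow> (evec \<Rightarrow> real) \<Rightarrow> evec set \<Rightarrow> real" where
  "m_bar n f \<Omega> = (LEAST m. lower_curvature n f \<Omega> m)"

definition phi :: "(evec \<Rightarrow> real) \<Rightarrow> (evec \<Rightarrow> ereal) \<Rightarrow> evec \<Rightarrow> ereal" where
  "phi f h z = ereal (f z) + h z"

definition phi_star :: "nat \<Rightarrow> (evec \<Rightarrow> real) \<Rightarrow> (evec \<Rightarrow> ereal) \<Rightarrow> ereal" where
  "phi_star n f h = (INF z\<in>Rn n. phi f h z)"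

definition optimal_set :: "nat \<Rightarrow> (evec \<Rightarrow> real) \<Rightarrow> (evec \<Rightarrow> ereal) \<Rightarrow> evec set" where
  "optimal_set n f h = {z \<in> Rn n. phi f h z = phi_star n f h}"

definition approx_solution ::
    "nat \<Rightarrow> (evec \<Rightarrow> real) \<Rightarrow> (evec \<Rightarrow> ereal) \<Rightarrow> real \<Rightarrow> evec \<Rightarrow> evec \<Rightarrow> bool" where
  "approx_solution n f h \<rho> y v \<longleftrightarrow>
     y \<in> Rn n \<and> v \<in> (+) (grad n f y) ` subdifferential n h y \<and> norm v \<le> \<rho>"


section \<open>NC-FISTA\<close>

definition nc_fista_input ::
    "nat \<Rightarrow> (evec \<Rightarrow> real) \<Rightarrow> (evec \<Rightarrow> ereal) \<Rightarrow> evec set \<Rightarrow>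
     evec \<Rightarrow> real \<Rightarrow> real \<Rightarrow> real \<Rightarrow> real \<Rightarrow> bool" where
  "nc_fista_input n f h \<Omega> y0 M m A0 \<rho> \<longleftrightarrow>
     y0 \<in> eff_dom n h \<and> M > 0 \<and> m > 0 \<and> M \<ge> m \<and> m \<ge> m_bar n f \<Omega> \<and> M > M_bar n f \<Omega> \<and>
     A0 > 0 \<and> \<rho> > 0"

text \<open>
  The locale has no assumptions; it only abbreviates parameter lists.  The iterates are defined for
  all \<open>k\<close>, ignoring the stopping test, which enters in \<open>outputs\<close>.
\<close>

locale nc_fista =
  fixes n :: nat and f :: "evec \<Rightarrow> real" and h :: "evec \<Rightarrow> ereal" and \<Omega> :: "evec set"
    and y0 :: evec and M m A0 \<rho> :: real
begin

definition lam :: real where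
  "lam = 1 / M"

definition kappa0 :: real where
  "kappa0 = (1 + sqrt (1 + 4 * A0)) / (sqrt (1 + 4 * A0) - 1)"

primrec A :: "nat \<Rightarrow> real" where
  "A 0 = A0"
| "A (Suc k) = A k + (1 + sqrt (1 + 4 * A k)) / 2"

definition a :: "nat \<Rightarrow> real" where
  "a k = (1 + sqrt (1 + 4 * A k)) / 2"

definition prox_coeff :: "nat \<Rightarrow> real" where
  "prox_coeff k = 1 / lam + kappa0 * m / a k"

definition extrapolate :: "nat \<Rightarrow> evec \<Rightarrow> evec \<Rightarrow> evec" where
  "extrapolate k y x = (A k / A (Suc k)) *\<^sub>R y + (a k / A (Suc k)) *\<^sub>R x"

definition next_y :: "nat \<Rightarrow> evec \<Rightarrow> evec" where
  "next_y k xt = arg_min_on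
     (\<lambda>u. ereal (linearization n f u xt) + h u + ereal (1 / 2 * prox_coeff k * (norm (u - xt))\<^sup>2))
     (Rn n)"

definition next_x_hat :: "nat \<Rightarrow> evec \<Rightarrow> evec \<Rightarrow> evec" where
  "next_x_hat k y y' =
     ((a k + kappa0 * m * lam) *\<^sub>R y' - (a k - 1) *\<^sub>R y) /\<^sub>R (kappa0 * m * lam + 1)"

text \<open>Orthogonal projection; the library's \<open>closest_point\<close> needs a \<open>heine_borel\<close> type.\<close>

definition proj :: "evec \<Rightarrow> evec" where
  "proj x = arg_min_on (\<lambda>u. dist x u) \<Omega>"

primrec iter :: "nat \<Rightarrow> evec \<times> evec" where
  "iter 0 = (y0, y0)"
| "iter (Suc k) =
     (let (y, x) = iter k;
          y' = next_y k (extrapolate k y x)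
      in (y', proj (next_x_hat k y y')))"

definition y :: "nat \<Rightarrow> evec" where
  "y k = fst (iter k)"

definition x :: "nat \<Rightarrow> evec" where
  "x k = snd (iter k)"

definition x_tilde :: "nat \<Rightarrow> evec" where
  "x_tilde k = extrapolate k (y k) (x k)"

text \<open>\<open>v_next k\<close> is the residual at index \<open>k + 1\<close>, belonging to \<open>y (Suc k)\<close>.\<close>

definition v_next :: "nat \<Rightarrow> evec" where
  "v_next k = prox_coeff k *\<^sub>R (x_tilde k - y (Suc k)) + grad n f (y (Suc k)) - grad n f (x_tilde k)"

text \<open>The algorithm stops in its \<open>N\<close>-th iteration, the one that computes \<open>y N\<close>.\<close>

definition outputs :: "nat \<Rightarrow> evec \<Rightarrow> evec \<Rightarrow> bool" where
  "outputs N y_hat v_hat \<longleftrightarrow>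
     (\<exists>k. N = Suc k \<and> norm (v_next k) \<le> \<rho> \<and> (\<forall>j<k. norm (v_next j) > \<rho>) \<and>
          y_hat = y (Suc k) \<and> v_hat = v_next k)"

end

end

theory Submission
  imports Defs
begin

text \<open>
  For an optimal solution \<open>z\<close> put
  \<open>E\<^sub>k = A\<^sub>k (\<phi>(y\<^sub>k) - \<phi>\<^sub>*) + (M + \<kappa>\<^sub>0m)/2 \<parallel>z - x\<^sub>k\<parallel>\<^sup>2\<close>.  As in the analysis of FISTA, one iteration
  decreases \<open>E\<^sub>k\<close> by \<open>a\<^sub>k\<^sup>2 (M - Mb)/2 \<parallel>y\<^sub>k\<^sub>+\<^sub>1 - xt\<^sub>k\<parallel>\<^sup>2\<close>, where \<open>xt\<close> is the extrapolated point, up to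
  errors caused by nonconvexity and by the additional proximal term.  The part of these errors
  proportional to \<open>\<parallel>z - x\<^sub>k\<parallel>\<^sup>2\<close> is absorbed in \<open>E\<^sub>k\<close>, because \<open>\<kappa>\<^sub>0\<close> is such that
  \<open>\<kappa>\<^sub>0 (1 - 1/a\<^sub>k) \<ge> 1\<close>; the terms in \<open>\<parallel>x\<^sub>k - y\<^sub>k\<parallel>\<^sup>2\<close> cancel exactly (so \<open>\<Omega>\<close> may be unbounded), and
  what is left is at most \<open>(mb a\<^sub>k + \<kappa>\<^sub>0m) D\<^sub>h\<^sup>2/2\<close>.  Since
  \<open>\<parallel>v\<^sub>k\<^sub>+\<^sub>1\<parallel> \<le> (2 + \<kappa>\<^sub>0) M \<parallel>y\<^sub>k\<^sub>+\<^sub>1 - xt\<^sub>k\<parallel>\<close>, summing over \<open>N\<close> iterations without success bounds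
  \<open>\<rho>\<^sup>2/M \<Sum>a\<^sub>k\<^sup>2\<close> by a multiple of \<open>E\<^sub>0 + mb D\<^sub>h\<^sup>2 \<Sum>a\<^sub>k + m D\<^sub>h\<^sup>2 N\<close>.  As \<open>a\<^sub>k \<ge> (k + 1)/2\<close>, the sum
  on the left is at least of order \<open>N\<^sup>3\<close> and of order \<open>N \<Sum>a\<^sub>k\<close>, which gives the three terms.
\<close>

section \<open>Compactness in \<open>Rn n\<close>\<close>

lemma coord_zero [simp]: "coord 0 i = 0"
  by (simp add: zero_evec.rep_eq)

lemma coord_add [simp]: "coord (x + y) i = coord x i + coord y i"
  by (simp add: plus_evec.rep_eq)

lemma coord_diff [simp]: "coord (x - y) i = coord x i - coord y i"
  by (simp add: minus_evec.rep_eq)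

lemma coord_scaleR [simp]: "coord (c *\<^sub>R x) i = c * coord x i"
  by (simp add: scaleR_evec.rep_eq)

lemma coord_sum [simp]: "coord (\<Sum>j\<in>S. g j) i = (\<Sum>j\<in>S. coord (g j) i)"
  by (induction S rule: infinite_finite_induct) auto

lemma subspace_Rn: "subspace (Rn n)"
  by (auto simp: subspace_def Rn_def)

lemmas Rn_intros = subspace_add[OF subspace_Rn] subspace_diff[OF subspace_Rn]
  subspace_scale[OF subspace_Rn] subspace_0[OF subspace_Rn]

lemma abs_coord_le_norm: "\<bar>coord x i\<bar> \<le> norm x"
proof -
  have "(coord x i)\<^sup>2 \<le> inner x x"
  proof (cases "coord x i = 0")
    case False
    then have "coord x i * coord x i \<le> (\<Sum>j | coord x j \<noteq> 0. coord x j * coord x j)"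
      by (intro member_le_sum) (auto simp: finite_support)
    then show ?thesis
      by (simp add: inner_evec_def power2_eq_square)
  qed simp
  then show ?thesis
    by (metis norm_eq_sqrt_inner real_sqrt_abs real_sqrt_le_mono)
qed

lemma bounded_linear_coord: "bounded_linear (\<lambda>x. coord x i)"
  by (rule bounded_linear_intro[where K = 1]) (auto simp: abs_coord_le_norm)

lemma closed_Rn: "closed (Rn n)"
proof -
  have "Rn n = (\<Inter>i\<in>{n..}. {x. coord x i = 0})"
    by (auto simp: Rn_def)
  moreover have "closed {x. coord x i = 0}" for i
    by (intro closed_Collect_eq continuous_intros
        linear_continuous_on[OF bounded_linear_coord])
  ultimately show ?thesis
    by (simp add: closed_INT)
qed

definition unit_evec :: "nat \<Rightarrow> evec" where
  "unit_evec i = Abs_evec (\<lambda>j. if j = i then 1 else 0)"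

lemma coord_unit_evec [simp]: "coord (unit_evec i) j = (if j = i then 1 else 0)"
  unfolding unit_evec_def by (subst Abs_evec_inverse) auto

lemma unit_evec_in_Rn: "i < n \<Longrightarrow> unit_evec i \<in> Rn n"
  by (auto simp: Rn_def)

lemma Rn_expansion:
  assumes "x \<in> Rn n"
  shows "x = (\<Sum>i<n. coord x i *\<^sub>R unit_evec i)"
  using assms by (intro evec_eqI) (auto simp: Rn_def if_distrib cong: if_cong)

text \<open>By induction on the dimension: the next cube is a continuous image of the product of the
  previous one with an interval. Compactness is built inside \<open>Rn n\<close>, because closed
  balls of the infinite-dimensional type \<open>evec\<close> are not compact.\<close>

lemma compact_cube: "compact {\<Sum>i<n. c i *\<^sub>R unit_evec i |c. \<forall>i. \<bar>c i\<bar> \<le> B}"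
proof (induction n)
  case 0
  have "{\<Sum>i<0. c i *\<^sub>R unit_evec i |c. \<forall>i. \<bar>c i\<bar> \<le> B} \<subseteq> {0}"
    by auto
  then show ?case
    using finite_imp_compact finite_subset by blast
next
  case (Suc n)
  let ?C = "{\<Sum>i<n. c i *\<^sub>R unit_evec i |c. \<forall>i. \<bar>c i\<bar> \<le> B}"
  let ?F = "\<lambda>p. fst p + snd p *\<^sub>R unit_evec n"
  have "{\<Sum>i<Suc n. c i *\<^sub>R unit_evec i |c. \<forall>i. \<bar>c i\<bar> \<le> B} = ?F ` (?C \<times> {-B..B})"
    (is "?L = ?R")
  proof
    show "?L \<subseteq> ?R"
    proof clarify
      fix c :: "nat \<Rightarrow> real"
      assume c: "\<forall>i. \<bar>c i\<bar> \<le> B"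
      then have "c n \<in> {-B..B}"
        by (simp add: abs_le_iff minus_le_iff)
      with c have "(\<Sum>i<n. c i *\<^sub>R unit_evec i, c n) \<in> ?C \<times> {-B..B}"
        by blast
      from imageI[OF this, of ?F] show "(\<Sum>i<Suc n. c i *\<^sub>R unit_evec i) \<in> ?R"
        by simp
    qed
    show "?R \<subseteq> ?L"
    proof clarify
      fix c :: "nat \<Rightarrow> real" and t :: real
      assume "\<forall>i. \<bar>c i\<bar> \<le> B" "t \<in> {-B..B}"
      then have "\<forall>i. \<bar>(c(n := t)) i\<bar> \<le> B"
        by (simp add: abs_le_iff)
      then show "\<exists>c'. ?F (\<Sum>i<n. c i *\<^sub>R unit_evec i, t) = (\<Sum>i<Suc n. c' i *\<^sub>R unit_evec i)
          \<and> (\<forall>i. \<bar>c' i\<bar> \<le> B)"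
        by (intro exI[of _ "c(n := t)"]) simp
    qed
  qed
  moreover have "compact (?F ` (?C \<times> {-B..B}))"
    by (intro compact_continuous_image continuous_intros compact_Times Suc.IH) simp
  ultimately show ?case
    by simp
qed

text \<open>Coordinates are bounded by the norm, so \<open>S\<close> is a closed subset of a compact
  cube.\<close>

lemma compact_Rn:
  assumes "closed S" "bounded S" "S \<subseteq> Rn n"
  shows "compact S"
proof -
  obtain B where B: "\<And>x. x \<in> S \<Longrightarrow> norm x \<le> B"
    using assms(2) by (auto simp: bounded_iff)
  let ?C = "{\<Sum>i<n. c i *\<^sub>R unit_evec i |c. \<forall>i. \<bar>c i\<bar> \<le> B}"
  have "S \<subseteq> ?C"
  proof
    fix x assume "x \<in> S"
    then have "x = (\<Sum>i<n. coord x i *\<^sub>R unit_evec i)"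
      using assms(3) by (intro Rn_expansion) auto
    moreover have "\<forall>i. \<bar>coord x i\<bar> \<le> B"
      using B[OF \<open>x \<in> S\<close>] by (blast intro: order_trans abs_coord_le_norm)
    ultimately show "x \<in> ?C" by blast
  qed
  then show ?thesis
    using compact_Int_closed[OF compact_cube assms(1), of n B] by (simp add: inf.absorb2)
qed


section \<open>Existence of minimizers\<close>

text \<open>At a limit point with value above \<open>c\<close>, all nearby points of
  \<open>S\<close> would have values above \<open>c\<close>, although points with values at most
  \<open>c\<close> accumulate there.\<close>

lemma closed_sublevel:
  fixes g :: "'a::t1_space \<Rightarrow> 'b::linorder"
  assumes "closed S" and lsc: "\<And>z. z \<in> S \<Longrightarrow> c < g z \<Longrightarrow> \<forall>\<^sub>F w in at z within S. c < g w"
  shows "closed {z \<in> S. g z \<le> c}"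
  unfolding closed_limpt
proof (intro allI impI)
  fix z assume z: "z islimpt {z \<in> S. g z \<le> c}" (is "z islimpt ?T")
  have "z \<in> S"
    using islimpt_subset[OF z, of S] assms(1) by (auto simp: closed_limpt)
  have "\<not> c < g z"
  proof
    assume "c < g z"
    have "\<forall>\<^sub>F w in at z within ?T. c < g w"
      by (rule filter_leD[OF at_le lsc[OF \<open>z \<in> S\<close> \<open>c < g z\<close>]]) auto
    moreover have "\<forall>\<^sub>F w in at z within ?T. g w \<le> c"
      unfolding eventually_at_filter by (rule always_eventually) simp
    ultimately have "\<forall>\<^sub>F w in at z within ?T. False"
      by eventually_elim simp
    then show False
      using z by (simp add: trivial_limit_within eventually_False)
  qed
  with \<open>z \<in> S\<close> show "z \<in> ?T" by simp
qed

text \<open>Without a minimizer the complements of the sublevel sets would cover \<open>S\<close>;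
  but the index of least value in a finite subcover lies in none of the chosen complements. The
  codomain is any linear order, so that \<open>ereal\<close> is included.\<close>

lemma compact_attains_min:
  fixes g :: "'a::topological_space \<Rightarrow> 'b::linorder"
  assumes "compact S" "S \<noteq> {}" and cl: "\<And>z. z \<in> S \<Longrightarrow> closed {w \<in> S. g w \<le> g z}"
  shows "\<exists>z\<in>S. \<forall>w\<in>S. g z \<le> g w"
proof (rule ccontr)
  assume "\<not> ?thesis"
  then have "S \<subseteq> (\<Union>z\<in>S. - {w \<in> S. g w \<le> g z})"
    by blast
  moreover have "open (- {w \<in> S. g w \<le> g z})" if "z \<in> S" for z
    using cl[OF that] by (rule open_Compl)
  ultimately obtain T where T: "T \<subseteq> S" "finite T" "S \<subseteq> (\<Union>z\<in>T. - {w \<in> S. g w \<le> g z})"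
    using compactE_image[OF assms(1), of S "\<lambda>z. - {w \<in> S. g w \<le> g z}"] by blast
  with assms(2) have "T \<noteq> {}" by auto
  with T(2) obtain t where t: "t \<in> T" "\<And>u. u \<in> T \<Longrightarrow> g t \<le> g u"
    using arg_min_if_finite(1)[of T g] arg_min_least[of T _ g] by blast
  with T obtain u where "u \<in> T" "\<not> g t \<le> g u" by blast
  with t show False by blast
qed

text \<open>For a real level \<open>r\<close>, a number \<open>t\<close> strictly between
  \<open>r - q z\<close> and \<open>h z\<close> separates the summands: nearby, \<open>h\<close>
  stays above \<open>t\<close> and \<open>q\<close> above \<open>r - t\<close>. For the level
  -\<infinity> properness suffices.\<close>

lemma lsc_add_continuous:
  assumes h: "proper n h" "lower_semicontinuous n h" and T: "T \<subseteq> Rn n" "continuous_on T q"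
    and z: "z \<in> T" "c < ereal (q z) + h z"
  shows "\<forall>\<^sub>F w in at z within T. c < ereal (q w) + h w"
proof (cases c)
  case PInf
  then show ?thesis using z by simp
next
  case MInf
  have "\<forall>\<^sub>F w in at z within T. w \<in> T"
    unfolding eventually_at_filter by (rule always_eventually) simp
  then show ?thesis
  proof eventually_elim
    case (elim w)
    with h T(1) have "h w > -\<infinity>" by (auto simp: proper_def)
    then show ?case using MInf by (cases "h w") auto
  qed
next
  case (real r)
  have "ereal (r - q z) < h z"
    using z(2) real by (cases "h z") auto
  then obtain t where t: "ereal (r - q z) < ereal t" "ereal t < h z"
    using ereal_dense2 by blast
  have "h z \<le> Liminf (at z within Rn n) h"
    using h z T by (auto simp: lower_semicontinuous_def)
  then have "\<forall>\<^sub>F w in at z within Rn n. ereal t < h w"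
    using t(2) by (auto simp: le_Liminf_iff)
  then have 1: "\<forall>\<^sub>F w in at z within T. ereal t < h w"
    by (rule filter_leD[OF at_le[OF T(1)]])
  have "(q \<longlongrightarrow> q z) (at z within T)"
    using T z by (auto simp: continuous_on_def)
  then have "\<forall>\<^sub>F w in at z within T. r - t < q w"
    using t(1) by (intro order_tendstoD(1)) auto
  with 1 show ?thesis
  proof eventually_elim
    case (elim w)
    then show ?case using real by (cases "h w") auto
  qed
qed

text \<open>Outside the bounded domain the objective is \<infinity>, so a minimum over a compact set
  containing the domain is global. The set \<open>T\<close>, on which \<open>q\<close> is
  continuous, will be \<open>\<Omega>\<close> for the problem itself and \<open>Rn n\<close> for the
  proximal subproblems.\<close>

lemma composite_attains_min:
  assumes h: "assumption_A1 n h" "assumption_A2 n h"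
    and T: "closed T" "eff_dom n h \<subseteq> T" "T \<subseteq> Rn n" "continuous_on T q"
  shows "\<exists>z\<in>eff_dom n h. \<forall>u\<in>Rn n. ereal (q z) + h z \<le> ereal (q u) + h u"
proof -
  let ?g = "\<lambda>z. ereal (q z) + h z"
  obtain B where B: "eff_dom n h \<subseteq> cball 0 B"
    using h(2) by (auto simp: assumption_A2_def bounded_iff subset_iff)
  let ?S = "T \<inter> cball 0 B"
  have cl: "closed ?S" and sub: "?S \<subseteq> Rn n"
    using T by auto
  have S: "compact ?S"
    by (rule compact_Rn[OF cl _ sub]) (simp add: bounded_Int)
  have ne: "eff_dom n h \<noteq> {}"
    using h by (auto simp: assumption_A1_def proper_def)
  have q: "continuous_on ?S q"
    using T(4) by (rule continuous_on_subset) auto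
  have "closed {w \<in> ?S. ?g w \<le> c}" for c
    by (rule closed_sublevel[OF cl], rule lsc_add_continuous[OF _ _ sub q])
      (use h in \<open>auto simp: assumption_A1_def\<close>)
  with compact_attains_min[OF S, of ?g] ne T(2) B
  obtain z where z: "z \<in> ?S" "\<And>w. w \<in> ?S \<Longrightarrow> ?g z \<le> ?g w"
    by blast
  from ne obtain w where w: "w \<in> eff_dom n h" by blast
  with z(2)[of w] T(2) B have "?g z \<le> ?g w" by blast
  with w have "h z < \<infinity>" by (auto simp: eff_dom_def)
  with z(1) sub have "z \<in> eff_dom n h" by (auto simp: eff_dom_def)
  moreover have "?g z \<le> ?g u" if "u \<in> Rn n" for u
  proof (cases "u \<in> eff_dom n h")
    case True
    then show ?thesis using z(2) T(2) B by blast
  next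
    case False
    then show ?thesis using that by (auto simp: eff_dom_def)
  qed
  ultimately show ?thesis by blast
qed

text \<open>Supplies the reference solution of the energy. The optimal set is a bounded sublevel
  set, hence compact, so the distance to it is attained.\<close>

lemma optimal_set_closest:
  assumes h: "assumption_A1 n h" "assumption_A2 n h"
    and T: "closed T" "eff_dom n h \<subseteq> T" "T \<subseteq> Rn n" "continuous_on T f"
  shows "\<exists>z\<in>eff_dom n h. z \<in> optimal_set n f h \<and> dist p z = infdist p (optimal_set n f h)"
proof -
  let ?Z = "optimal_set n f h"
  obtain z0 where z0: "z0 \<in> eff_dom n h" "\<And>u. u \<in> Rn n \<Longrightarrow> phi f h z0 \<le> phi f h u"
    using composite_attains_min[OF assms] by (auto simp: phi_def)
  then have star: "phi_star n f h = phi f h z0"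
    unfolding phi_star_def by (intro antisym INF_lower INF_greatest) (auto simp: eff_dom_def)
  have fin: "phi f h z0 < \<infinity>"
    using z0 by (auto simp: phi_def eff_dom_def)
  have Z_dom: "?Z \<subseteq> eff_dom n h"
  proof
    fix z assume "z \<in> ?Z"
    then show "z \<in> eff_dom n h"
      using fin star by (cases "h z") (auto simp: optimal_set_def phi_def eff_dom_def)
  qed
  have "?Z = {z \<in> T. ereal (f z) + h z \<le> phi_star n f h}"
  proof
    show "?Z \<subseteq> {z \<in> T. ereal (f z) + h z \<le> phi_star n f h}"
      using Z_dom T(2) by (auto simp: optimal_set_def phi_def)
    show "{z \<in> T. ereal (f z) + h z \<le> phi_star n f h} \<subseteq> ?Z"
      using T(3) z0(2) unfolding optimal_set_def star by (auto simp: phi_def intro!: antisym)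
  qed
  moreover have "closed \<dots>"
    by (rule closed_sublevel[OF T(1)], rule lsc_add_continuous[OF _ _ T(3,4)])
      (use h in \<open>auto simp: assumption_A1_def\<close>)
  ultimately have "closed ?Z" by simp
  moreover have "bounded ?Z"
    using Z_dom h(2) bounded_subset by (auto simp: assumption_A2_def)
  ultimately have cpt: "compact ?Z"
    using compact_Rn[of ?Z n] by (auto simp: optimal_set_def)
  have ne: "?Z \<noteq> {}"
    using z0 star by (auto simp: optimal_set_def eff_dom_def)
  have "continuous_on ?Z (dist p)"
    by (intro continuous_intros)
  from continuous_attains_inf[OF cpt ne this]
  obtain z where z: "z \<in> ?Z" "\<And>w. w \<in> ?Z \<Longrightarrow> dist p z \<le> dist p w"
    by blast
  then have "dist p z = infdist p ?Z"
    using ne by (intro antisym infdist_le) (auto simp: infdist_def intro!: cINF_greatest)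
  with z Z_dom show ?thesis by blast
qed


text \<open>\<open>arg_min_on\<close> is a choice operator; it is meaningful once some minimizer
  \<open>z\<close> is known to exist.\<close>

lemma arg_min_on_minimizes:
  fixes g :: "'a \<Rightarrow> 'b::linorder"
  assumes "z \<in> S" "\<And>u. u \<in> S \<Longrightarrow> g z \<le> g u"
  shows "arg_min_on g S \<in> S" "u \<in> S \<Longrightarrow> g (arg_min_on g S) \<le> g u"
proof -
  have "is_arg_min g (\<lambda>x. x \<in> S) z"
    using assms by (auto simp: is_arg_min_def not_less)
  then have "is_arg_min g (\<lambda>x. x \<in> S) (arg_min_on g S)"
    unfolding arg_min_on_def arg_min_def by (rule someI)
  then show "arg_min_on g S \<in> S" "u \<in> S \<Longrightarrow> g (arg_min_on g S) \<le> g u"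
    by (auto simp: is_arg_min_def not_less)
qed

lemma closest_point_Rn:
  assumes "closed S" "S \<noteq> {}" "S \<subseteq> Rn n"
  shows "\<exists>z\<in>S. \<forall>w\<in>S. dist p z \<le> dist p w"
proof -
  obtain w0 where w0: "w0 \<in> S" using assms(2) by blast
  let ?S = "S \<inter> cball p (dist p w0)"
  have "compact ?S"
    using assms by (intro compact_Rn[of _ n]) (auto simp: bounded_Int)
  moreover have "?S \<noteq> {}"
    using w0 by auto
  moreover have "continuous_on ?S (dist p)"
    by (intro continuous_intros)
  ultimately obtain z where z: "z \<in> ?S" "\<forall>w\<in>?S. dist p z \<le> dist p w"
    using continuous_attains_inf[of ?S "dist p"] by blast
  have "dist p z \<le> dist p w" if "w \<in> S" for w
  proof (cases "dist p w \<le> dist p w0")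
    case True
    then show ?thesis using z(2) that by simp
  next
    case False
    then show ?thesis using z(1) by simp
  qed
  with z(1) show ?thesis by blast
qed


section \<open>Gradients and curvature\<close>

text \<open>Riesz representation on \<open>Rn n\<close>, with the representing vector written
  out.\<close>

lemma inner_unit_evec:
  assumes "w \<in> Rn n" "linear F"
  shows "inner w (\<Sum>i<n. F (unit_evec i) *\<^sub>R unit_evec i) = F w"
proof -
  have 1: "inner w (unit_evec i) = coord w i" for i
    using inner_evec_superset[of "{i}" "unit_evec i" w] by (auto simp: inner_commute)
  have "F w = F (\<Sum>i<n. coord w i *\<^sub>R unit_evec i)"
    using Rn_expansion[OF assms(1)] by simp
  also have "\<dots> = (\<Sum>i<n. coord w i * F (unit_evec i))"
    using assms(2) by (simp add: linear_sum linear_scale)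
  finally show ?thesis
    by (simp add: inner_sum_right 1 mult.commute)
qed

text \<open>A derivative within \<open>Rn n\<close> says nothing about directions leaving
  \<open>Rn n\<close>. The direction \<open>g - g'\<close> stays inside, and along it the two
  candidates are derivatives of the same function of one real variable.\<close>

lemma has_derivative_inner_unique:
  assumes z: "z \<in> Rn n" and g: "g \<in> Rn n" "g' \<in> Rn n"
    and d: "(f has_derivative (\<lambda>w. inner w g)) (at z within Rn n)"
      "(f has_derivative (\<lambda>w. inner w g')) (at z within Rn n)"
  shows "g = g'"
proof -
  let ?u = "g - g'"
  have img: "(\<lambda>t. z + t *\<^sub>R ?u) ` UNIV \<subseteq> Rn n"
    using z g by (auto intro!: Rn_intros)
  have 1: "((\<lambda>t::real. z + t *\<^sub>R ?u) has_derivative (\<lambda>t. t *\<^sub>R ?u)) (at 0)"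
    by (auto intro!: derivative_eq_intros)
  have "((f \<circ> (\<lambda>t. z + t *\<^sub>R ?u)) has_derivative (\<lambda>t. t * inner ?u g'')) (at 0)"
    if "(f has_derivative (\<lambda>w. inner w g'')) (at z within Rn n)" for g''
    using diff_chain_within[OF 1, of f "\<lambda>w. inner w g''"] that
      has_derivative_subset[OF that img]
    by (simp add: o_def)
  from has_derivative_unique[OF this[OF d(1)] this[OF d(2)]]
  have "1 * inner ?u g = 1 * inner ?u g'" by metis
  then have "inner ?u ?u = 0" by (simp add: inner_diff_right)
  then show ?thesis by simp
qed

text \<open>Justifies the definite description in \<open>grad\<close>. The difference quotient only
  sees \<open>w - z\<close> with \<open>w\<close> in \<open>Rn n\<close>, where the derivative
  \<open>F\<close> agrees with its Riesz representative.\<close>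

lemma grad_works:
  assumes z: "z \<in> Rn n" and "f differentiable (at z within Rn n)"
  shows "grad n f z \<in> Rn n \<and>
    (f has_derivative (\<lambda>w. inner w (grad n f z))) (at z within Rn n)"
proof -
  from assms obtain F where F: "(f has_derivative F) (at z within Rn n)"
    by (auto simp: differentiable_def)
  then have "linear F"
    using bounded_linear.linear has_derivative_bounded_linear by blast
  define g where "g = (\<Sum>i<n. F (unit_evec i) *\<^sub>R unit_evec i)"
  have g: "g \<in> Rn n"
    unfolding g_def by (auto intro!: subspace_sum[OF subspace_Rn] Rn_intros unit_evec_in_Rn)
  have Fg: "F w = inner w g" if "w \<in> Rn n" for w
    using inner_unit_evec[OF that \<open>linear F\<close>] by (simp add: g_def)
  have "(f has_derivative (\<lambda>w. inner w g)) (at z within Rn n)"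
    unfolding has_derivative_within
  proof
    show "bounded_linear (\<lambda>w. inner w g)"
      by (rule bounded_linear_inner_left)
    have "((\<lambda>w. (1 / norm (w - z)) *\<^sub>R (f w - (f z + F (w - z)))) \<longlongrightarrow> 0) (at z within Rn n)"
      using F by (simp add: has_derivative_within)
    moreover have "\<forall>\<^sub>F w in at z within Rn n.
        (1 / norm (w - z)) *\<^sub>R (f w - (f z + F (w - z))) =
        (1 / norm (w - z)) *\<^sub>R (f w - (f z + inner (w - z) g))"
      unfolding eventually_at_filter
      by (rule always_eventually) (auto simp: Fg Rn_intros z)
    ultimately show "((\<lambda>w. (1 / norm (w - z)) *\<^sub>R (f w - (f z + inner (w - z) g))) \<longlongrightarrow> 0)
        (at z within Rn n)"
      by (rule Lim_transform_eventually)
  qed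
  with g have "\<exists>!g. g \<in> Rn n \<and> (f has_derivative (\<lambda>w. inner w g)) (at z within Rn n)"
    using has_derivative_inner_unique[OF z] by blast
  from theI'[OF this] show ?thesis
    unfolding grad_def .
qed

section \<open>Quadratic bounds on \<open>f\<close> and their smallest constants\<close>

text \<open>\<open>F\<close> is \<open>f\<close> along the segment minus the non-constant part of
  the asserted bound. Its derivative is nonpositive by Cauchy-Schwarz and the Lipschitz condition,
  so the mean value theorem gives \<open>F 1 \<le> F 0\<close>.\<close>

lemma descent_lemma:
  fixes f :: "'a::real_inner \<Rightarrow> real"
  assumes S: "convex S" "z \<in> S" "z' \<in> S"
    and d: "\<And>w. w \<in> S \<Longrightarrow> (f has_derivative (\<lambda>v. inner v (g w))) (at w within S)"
    and L: "L-lipschitz_on S g"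
  shows "f z' \<le> f z + inner (g z) (z' - z) + L / 2 * (norm (z' - z))\<^sup>2"
proof -
  define u where "u = z' - z"
  define p where "p t = z + t *\<^sub>R u" for t :: real
  define F where "F t = f (p t) - t * inner (g z) u - L / 2 * t\<^sup>2 * (norm u)\<^sup>2" for t
  have p: "p t \<in> S" if "t \<in> {0..1}" for t
  proof -
    have "p t = (1 - t) *\<^sub>R z + t *\<^sub>R z'"
      by (simp add: p_def u_def algebra_simps)
    then show ?thesis
      using S that convexD[of S z z' "1 - t" t] by auto
  qed
  let ?F' = "\<lambda>t s. s * inner u (g (p t)) - s * inner (g z) u - L * t * s * (norm u)\<^sup>2"
  have "(F has_derivative ?F' t) (at t within {0..1})" if "0 \<le> t" "t \<le> 1" for t
  proof -
    have "(p has_derivative (\<lambda>s. s *\<^sub>R u)) (at t within {0..1})"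
      unfolding p_def by (auto intro!: derivative_eq_intros)
    moreover have "(f has_derivative (\<lambda>v. inner v (g (p t)))) (at (p t) within p ` {0..1})"
      by (rule has_derivative_subset[OF d]) (use p that in auto)
    ultimately have "((\<lambda>t. f (p t)) has_derivative (\<lambda>s. inner (s *\<^sub>R u) (g (p t)))) (at t within {0..1})"
      using diff_chain_within by (fastforce simp: o_def)
    then show ?thesis
      unfolding F_def by (auto intro!: derivative_eq_intros simp: algebra_simps power2_eq_square)
  qed
  then obtain t where t: "t \<in> {0<..<1}" "F 1 - F 0 = ?F' t (1 - 0)"
    using mvt_simple[of 0 1 F ?F'] by auto
  have "inner u (g (p t)) - inner (g z) u = inner u (g (p t) - g z)"
    by (simp add: inner_diff_right inner_commute)
  also have "\<dots> \<le> norm u * norm (g (p t) - g z)"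
    by (rule norm_cauchy_schwarz)
  also have "\<dots> \<le> norm u * (L * (t * norm u))"
    using lipschitz_onD[OF L p S(2), of t] t
    by (intro mult_left_mono) (simp_all add: dist_norm p_def)
  finally have "inner u (g (p t)) - inner (g z) u \<le> L * t * (norm u)\<^sup>2"
    by (simp add: power2_eq_square mult_ac)
  with t(2) have "F 1 \<le> F 0" by simp
  then show ?thesis
    by (simp add: F_def p_def u_def)
qed

text \<open>Over the reals \<open>LEAST\<close> denotes a least element only if the infimum is
  attained; this makes \<open>M_bar\<close> and \<open>m_bar\<close> usable.\<close>

lemma Least_attained:
  fixes P :: "real \<Rightarrow> bool"
  assumes "closed {t. P t}" "P t0" "\<And>t. P t \<Longrightarrow> b \<le> t"
  shows "P (LEAST t. P t)"
proof -
  have bdd: "bdd_below {t. P t}"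
    using assms(3) by (auto simp: bdd_below_def)
  then have "P (Inf {t. P t})"
    using closed_contains_Inf[of "{t. P t}"] assms(1,2) by auto
  moreover have "Inf {t. P t} \<le> t" if "P t" for t
    using cInf_lower[of t "{t. P t}"] bdd that by simp
  ultimately show ?thesis
    by (metis (mono_tags, lifting) Least_equality)
qed

lemma M_bar_lipschitz:
  assumes "assumption_A3 n f h \<Omega>"
  shows "(M_bar n f \<Omega>)-lipschitz_on \<Omega> (grad n f)"
proof -
  obtain L where L: "L-lipschitz_on \<Omega> (grad n f)"
    using assms by (auto simp: assumption_A3_def)
  have "closed {t. t-lipschitz_on \<Omega> (grad n f)}"
    unfolding lipschitz_on_def Ball_def
    by (intro closed_Collect_conj closed_Collect_all closed_Collect_imp closed_Collect_le
        continuous_intros open_Collect_const)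
  from this L show ?thesis
    unfolding M_bar_def
    by (rule Least_attained[where b = 0]) (rule lipschitz_on_nonneg)
qed

text \<open>The gradient inequalities at the convex combination \<open>?w\<close> are averaged with
  its own weights, which cancels the linear terms.\<close>

lemma convex_on_gradient_ineq:
  fixes f :: "'a::real_inner \<Rightarrow> real"
  assumes S: "convex S"
    and ineq: "\<And>z z'. z \<in> S \<Longrightarrow> z' \<in> S \<Longrightarrow> f z + inner (g z) (z' - z) \<le> f z'"
  shows "convex_on S f"
proof (rule convex_onI)
  fix t :: real and x y
  assume t: "0 < t" "t < 1" and xy: "x \<in> S" "y \<in> S"
  let ?w = "(1 - t) *\<^sub>R x + t *\<^sub>R y"
  have w: "?w \<in> S"
    using S t xy convexD[of S x y "1 - t" t] by auto
  have "(1 - t) * (f ?w + inner (g ?w) (x - ?w)) + t * (f ?w + inner (g ?w) (y - ?w))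
      \<le> (1 - t) * f x + t * f y"
    using t ineq[OF w] xy by (intro add_mono mult_left_mono) auto
  moreover have "(1 - t) * inner (g ?w) (x - ?w) + t * inner (g ?w) (y - ?w)
      = inner (g ?w) ((1 - t) *\<^sub>R (x - ?w) + t *\<^sub>R (y - ?w))"
    by (simp only: inner_add_right inner_scaleR_right)
  moreover have "(1 - t) *\<^sub>R (x - ?w) + t *\<^sub>R (y - ?w) = 0"
    by (simp add: algebra_simps)
  ultimately show "f ?w \<le> (1 - t) * f x + t * f y"
    by (simp add: algebra_simps)
qed (fact S)

text \<open>\<open>h\<close> is finite on its domain, so arguments about subgradients can be carried
  out with real values there.\<close>

lemma convex_ext_real:
  assumes "assumption_A1 n h"
  shows "convex_on (eff_dom n h) (\<lambda>z. real_of_ereal (h z))"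
    and ereal_h: "z \<in> eff_dom n h \<Longrightarrow> ereal (real_of_ereal (h z)) = h z"
proof -
  have fin: "ereal (real_of_ereal (h z)) = h z" if "z \<in> eff_dom n h" for z
    using that assms by (cases "h z") (auto simp: eff_dom_def assumption_A1_def proper_def)
  then show "z \<in> eff_dom n h \<Longrightarrow> ereal (real_of_ereal (h z)) = h z" .
  have *: "u *\<^sub>R x + v *\<^sub>R y \<in> eff_dom n h \<and>
      h (u *\<^sub>R x + v *\<^sub>R y) \<le> ereal (u * real_of_ereal (h x) + v * real_of_ereal (h y))"
    if "x \<in> eff_dom n h" "y \<in> eff_dom n h" "u \<ge> 0" "v \<ge> 0" "u + v = 1" for x y u v
  proof -
    have R: "x \<in> Rn n" "y \<in> Rn n"
      using that by (auto simp: eff_dom_def)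
    then have "h (u *\<^sub>R x + v *\<^sub>R y) \<le> ereal u * h x + ereal v * h y"
      using assms that(3-5) by (auto simp: assumption_A1_def convex_ext_def)
    also have "\<dots> = ereal (u * real_of_ereal (h x) + v * real_of_ereal (h y))"
      by (subst (1 2) fin[symmetric]) (use that in auto)
    finally show ?thesis
      using R by (auto simp: eff_dom_def intro!: Rn_intros)
  qed
  show "convex_on (eff_dom n h) (\<lambda>z. real_of_ereal (h z))"
    unfolding convex_on_def
  proof (intro conjI ballI allI impI)
    show "convex (eff_dom n h)"
      using * by (auto simp: convex_def)
    fix x y :: evec and u v :: real
    assume "x \<in> eff_dom n h" "y \<in> eff_dom n h" "u \<ge> 0" "v \<ge> 0" "u + v = 1"
    from *[OF this] fin show "real_of_ereal (h (u *\<^sub>R x + v *\<^sub>R y))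
        \<le> u * real_of_ereal (h x) + v * real_of_ereal (h y)"
      by (metis ereal_less_eq(3))
  qed
qed

text \<open>The nonconvexity in A4 bounds the admissible constants from below: a negative one would
  imply the gradient inequality, hence convexity, on the domain.\<close>

lemma m_bar_curvature:
  assumes "assumption_A1 n h" "assumption_A3 n f h \<Omega>" "assumption_A4 n f h \<Omega>"
  shows "lower_curvature n f \<Omega> (m_bar n f \<Omega>)" "m_bar n f \<Omega> \<ge> 0"
proof -
  have pos: "0 \<le> t" if t: "lower_curvature n f \<Omega> t" for t
  proof (rule ccontr)
    assume neg: "\<not> 0 \<le> t"
    have "convex_on (eff_dom n h) f"
    proof (rule convex_on_gradient_ineq)
      show "convex (eff_dom n h)"
        using convex_ext_real(1)[OF assms(1)] by (simp add: convex_on_def)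
      fix z z' assume "z \<in> eff_dom n h" "z' \<in> eff_dom n h"
      then have "- (t / 2) * (norm (z' - z))\<^sup>2 \<le> f z' - linearization n f z' z"
        using t assms(2) by (auto simp: lower_curvature_def assumption_A3_def)
      moreover have "0 \<le> - (t / 2) * (norm (z' - z))\<^sup>2"
        using neg by (intro mult_nonneg_nonneg) auto
      ultimately show "f z + inner (grad n f z) (z' - z) \<le> f z'"
        by (simp add: linearization_def)
    qed
    then show False
      using assms(3) by (simp add: assumption_A4_def)
  qed
  obtain t where t: "lower_curvature n f \<Omega> t"
    using assms(3) by (auto simp: assumption_A4_def)
  have "closed {t. lower_curvature n f \<Omega> t}"
    unfolding lower_curvature_def Ball_def
    by (intro closed_Collect_all closed_Collect_imp closed_Collect_le
        continuous_intros open_Collect_const) auto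
  from this t pos show "lower_curvature n f \<Omega> (m_bar n f \<Omega>)"
    unfolding m_bar_def by (rule Least_attained)
  then show "m_bar n f \<Omega> \<ge> 0" by (rule pos)
qed


section \<open>One iteration\<close>

text \<open>Divide by \<open>t\<close> and let \<open>t\<close> tend to 0 from the right.\<close>

lemma linear_term_nonneg:
  fixes \<alpha> \<beta> :: real
  assumes "\<And>t. 0 < t \<Longrightarrow> t \<le> 1 \<Longrightarrow> 0 \<le> t * \<alpha> + t\<^sup>2 * \<beta>"
  shows "0 \<le> \<alpha>"
proof (rule tendsto_lowerbound)
  show "((\<lambda>t. \<alpha> + t * \<beta>) \<longlongrightarrow> \<alpha>) (at_right 0)"
    by (auto intro!: tendsto_eq_intros)
  have "\<forall>\<^sub>F t in at_right 0. t \<in> {0<..<1::real}"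
    by (rule eventually_at_right_real) simp
  then show "\<forall>\<^sub>F t in at_right 0. 0 \<le> \<alpha> + t * \<beta>"
  proof eventually_elim
    case (elim t)
    then have "0 \<le> t * (\<alpha> + t * \<beta>)"
      using assms[of t] by (simp add: algebra_simps power2_eq_square)
    then show ?case
      using elim by (simp add: zero_le_mult_iff)
  qed
qed simp

text \<open>First-order optimality, obtained by comparing \<open>p\<close> with the points
  \<open>p + t *\<^sub>R (u - p)\<close> for small \<open>t\<close>. With \<open>h = 0\<close>,
  \<open>g = 0\<close> and \<open>\<tau> = 2\<close> it also describes orthogonal
  projections.\<close>

lemma prox_subgradient:
  fixes g p x u :: "'a::real_inner" and h :: "'a \<Rightarrow> real"
  assumes h: "convex_on D h" and D: "p \<in> D" "u \<in> D"
    and min: "\<And>w. w \<in> D \<Longrightarrow>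
      inner g p + h p + \<tau> / 2 * (norm (p - x))\<^sup>2 \<le> inner g w + h w + \<tau> / 2 * (norm (w - x))\<^sup>2"
  shows "h p + inner (\<tau> *\<^sub>R (x - p) - g) (u - p) \<le> h u"
proof -
  let ?\<alpha> = "inner g (u - p) + h u - h p + \<tau> * inner (p - x) (u - p)"
  have "0 \<le> ?\<alpha>"
  proof (rule linear_term_nonneg)
    fix t :: real assume t: "0 < t" "t \<le> 1"
    let ?w = "p + t *\<^sub>R (u - p)"
    have w: "?w = (1 - t) *\<^sub>R p + t *\<^sub>R u"
      by (simp add: algebra_simps)
    have "?w \<in> D"
      unfolding w using h D t by (intro convexD) (auto simp: convex_on_def)
    let ?I = "inner (p - x) (u - p)" and ?G = "inner g (u - p)" and ?n = "(norm (u - p))\<^sup>2"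
    have h_le: "h ?w \<le> (1 - t) * h p + t * h u"
      unfolding w using t D by (intro convex_onD[OF h]) auto
    have norm_eq: "(norm (?w - x))\<^sup>2 = (norm (p - x))\<^sup>2 + 2 * t * ?I + t\<^sup>2 * ?n"
    proof -
      have "?w - x = (p - x) + t *\<^sub>R (u - p)"
        by simp
      moreover have "(norm (b + t *\<^sub>R c))\<^sup>2 = (norm b)\<^sup>2 + 2 * t * inner b c + t\<^sup>2 * (norm c)\<^sup>2"
        for b c :: 'a
        unfolding power2_norm_eq_inner
        by (simp add: inner_simps inner_commute algebra_simps power2_eq_square)
      ultimately show ?thesis
        by metis
    qed
    have inner_eq: "inner g ?w = inner g p + t * ?G"
      by (simp only: inner_add_right inner_scaleR_right)
    have "inner g p + h p + \<tau> / 2 * (norm (p - x))\<^sup>2 \<le> inner g p + t * ?G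
        + ((1 - t) * h p + t * h u) + \<tau> / 2 * ((norm (p - x))\<^sup>2 + 2 * t * ?I + t\<^sup>2 * ?n)"
      using min[OF \<open>?w \<in> D\<close>] h_le unfolding norm_eq inner_eq by linarith
    moreover have "(1 - t) * h p = h p - t * h p"
      by (simp add: left_diff_distrib)
    moreover have "\<tau> / 2 * ((norm (p - x))\<^sup>2 + 2 * t * ?I + t\<^sup>2 * ?n)
        = \<tau> / 2 * (norm (p - x))\<^sup>2 + t * (\<tau> * ?I) + t\<^sup>2 * (\<tau> / 2 * ?n)"
      by (simp only: distrib_left mult_ac times_divide_eq_right times_divide_eq_left)
    ultimately show "0 \<le> t * ?\<alpha> + t\<^sup>2 * (\<tau> / 2 * ?n)"
      unfolding distrib_left right_diff_distrib by linarith
  qed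
  then show ?thesis
    by (simp add: inner_simps inner_commute algebra_simps)
qed

text \<open>\<open>xh\<close> minimizes \<open>a \<gamma>(u) + M/2 \<parallel>u - x\<parallel>\<^sup>2\<close> for a \<open>\<mu>/a\<close>-strongly convex model
  \<open>\<gamma>\<close> of \<open>F\<close>; this is why the factor of the squared distance to \<open>z\<close> increases from \<open>M\<close> to
  \<open>M + \<mu>\<close>.\<close>

lemma accelerated_step:
  fixes x xt xh y y' z G :: "'a::real_inner"
  assumes a: "a > 1" and \<mu>: "\<mu> \<ge> 0" and M: "M > 0"
    and xt: "a *\<^sub>R xt = (a - 1) *\<^sub>R y + x"
    and xh: "(M + \<mu>) *\<^sub>R xh = (M * a + \<mu>) *\<^sub>R y' - (M * (a - 1)) *\<^sub>R y"
    and key: "\<And>u. u \<in> {y, z} \<Longrightarrow> F' \<le> F u + L / 2 * (norm (y' - xt))\<^sup>2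
      + (M + \<mu> / a) * inner (y' - xt) (u - y') + l / 2 * (norm (u - xt))\<^sup>2"
  shows "a\<^sup>2 * F' + a\<^sup>2 * ((M - L) / 2) * (norm (y' - xt))\<^sup>2 + (M + \<mu>) / 2 * (norm (z - xh))\<^sup>2
    \<le> a * (a - 1) * F y + a * F z + M / 2 * (norm (z - x))\<^sup>2
      + (l + \<mu> / a) / 2 * ((a - 1) * (norm (y - z))\<^sup>2 + (norm (z - x))\<^sup>2)"
proof -
  \<comment> \<open>Relative to \<open>xt\<close> all points are combinations of \<open>w\<close>,
    \<open>d\<close> and \<open>p\<close>; in particular
    \<open>x = xt - (a - 1) *\<^sub>R w\<close>.\<close>
  define w d p where "w = y - xt" and "d = z - xt" and "p = y' - xt"
  have y: "y = xt + w" and z: "z = xt + d" and y': "y' = xt + p"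
    by (simp_all add: w_def d_def p_def)
  have x: "x = xt - (a - 1) *\<^sub>R w"
  proof -
    have "x = a *\<^sub>R xt - (a - 1) *\<^sub>R y" using xt by simp
    then show ?thesis by (simp add: w_def algebra_simps)
  qed
  \<comment> \<open>\<open>xh - z\<close> is a weighted mean of two vectors with weights
    proportional to \<open>M\<close> and \<open>\<mu>\<close>, so convexity of the squared norm
    applies.\<close>
  have "(M + \<mu>) *\<^sub>R (xh - z) = M *\<^sub>R (a *\<^sub>R p - (a - 1) *\<^sub>R w - d) + \<mu> *\<^sub>R (p - d)"
    unfolding scaleR_diff_right xh y z y' by (simp add: algebra_simps)
  then have "(norm ((M + \<mu>) *\<^sub>R (xh - z)))\<^sup>2
      = (norm (M *\<^sub>R (a *\<^sub>R p - (a - 1) *\<^sub>R w - d) + \<mu> *\<^sub>R (p - d)))\<^sup>2"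
    by simp
  also have "\<dots> = (M + \<mu>) * (M * (norm (a *\<^sub>R p - (a - 1) *\<^sub>R w - d))\<^sup>2 + \<mu> * (norm (p - d))\<^sup>2)
      - M * \<mu> * (norm (a *\<^sub>R p - (a - 1) *\<^sub>R w - d - (p - d)))\<^sup>2"
  proof -
    have "(norm (M *\<^sub>R b + \<mu> *\<^sub>R c))\<^sup>2
      = (M + \<mu>) * (M * (norm b)\<^sup>2 + \<mu> * (norm c)\<^sup>2) - M * \<mu> * (norm (b - c))\<^sup>2" for b c :: 'a
      by (simp add: power2_norm_eq_inner inner_simps inner_commute algebra_simps)
    then show ?thesis .
  qed
  also have "\<dots> \<le> (M + \<mu>) * (M * (norm (a *\<^sub>R p - (a - 1) *\<^sub>R w - d))\<^sup>2 + \<mu> * (norm (p - d))\<^sup>2)"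
    using M \<mu> by simp
  finally have "(M + \<mu>) * ((M + \<mu>) * (norm (xh - z))\<^sup>2) \<le> (M + \<mu>) *
      (M * (norm (a *\<^sub>R p - (a - 1) *\<^sub>R w - d))\<^sup>2 + \<mu> * (norm (p - d))\<^sup>2)"
    using M \<mu> by (simp add: power_mult_distrib power2_eq_square mult_ac)
  then have "(M + \<mu>) * (norm (xh - z))\<^sup>2
      \<le> M * (norm (a *\<^sub>R p - (a - 1) *\<^sub>R w - d))\<^sup>2 + \<mu> * (norm (p - d))\<^sup>2"
    using M \<mu> by simp
  then have xh_le: "(M + \<mu>) / 2 * (norm (z - xh))\<^sup>2
      \<le> M / 2 * (norm (a *\<^sub>R p - (a - 1) *\<^sub>R w - d))\<^sup>2 + \<mu> / 2 * (norm (p - d))\<^sup>2"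
    by (simp add: norm_minus_commute)
  let ?n = "(norm p)\<^sup>2" and ?s = "(a - 1) * (norm (w - d))\<^sup>2 + (norm ((a - 1) *\<^sub>R w + d))\<^sup>2"
  let ?iw = "inner p (w - p)" and ?id = "inner p (d - p)"
  let ?nw = "(norm w)\<^sup>2" and ?nd = "(norm d)\<^sup>2"
  \<comment> \<open>\<open>key\<close> is used at \<open>y\<close> with weight
    \<open>a * (a - 1)\<close> and at \<open>z\<close> with weight \<open>a\<close>; the weights add
    up to \<open>a\<^sup>2\<close>.\<close>
  have sum: "a * (a - 1) * F' + a * F' \<le>
      a * (a - 1) * (F y + L / 2 * ?n + (M + \<mu> / a) * ?iw + l / 2 * ?nw)
      + a * (F z + L / 2 * ?n + (M + \<mu> / a) * ?id + l / 2 * ?nd)"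
    using key[of y] key[of z] a
    by (intro add_mono mult_left_mono) (auto simp: w_def d_def p_def)
  \<comment> \<open>The cross terms of the expanded squares cancel the inner products coming from
    \<open>key\<close>. The subtracted squares on the right are later dropped.\<close>
  have prox: "M / 2 * (norm (a *\<^sub>R p - (a - 1) *\<^sub>R w - d))\<^sup>2 + \<mu> / 2 * (norm (p - d))\<^sup>2
      + a * (a - 1) * ((M + \<mu> / a) * ?iw) + a * ((M + \<mu> / a) * ?id)
      + a\<^sup>2 * M / 2 * ?n
    = M / 2 * (norm ((a - 1) *\<^sub>R w + d))\<^sup>2 + \<mu> / (2 * a) * ?s
      - \<mu> / 2 * ((a - 1) * (norm (p - w))\<^sup>2 + a * ?n)"
    using a unfolding power2_norm_eq_inner inner_simps
    by (simp add: inner_commute field_simps power2_eq_square)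
  \<comment> \<open>Distances from \<open>xt\<close> become distances from \<open>z\<close> to
    \<open>y\<close> and to \<open>x\<close>; the squared distance between \<open>x\<close> and
    \<open>y\<close> cancels here.\<close>
  have dist: "a * (a - 1) * ?nw + a * ?nd = ?s"
    by (simp add: power2_norm_eq_inner inner_simps inner_commute algebra_simps)
  have nonneg: "0 \<le> \<mu> / 2 * ((a - 1) * (norm (p - w))\<^sup>2 + a * ?n)"
    using \<mu> a by simp
  have "a * (a - 1) * (F1 + L / 2 * n + \<tau> * i1 + l / 2 * n1) + a * (F2 + L / 2 * n + \<tau> * i2 + l / 2 * n2)
      = a * (a - 1) * F1 + a * F2 + a\<^sup>2 * L / 2 * n + (a * (a - 1) * (\<tau> * i1) + a * (\<tau> * i2))
      + l / 2 * (a * (a - 1) * n1 + a * n2)" for F1 F2 n \<tau> i1 i2 n1 n2 :: real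
    by (simp add: field_simps power2_eq_square)
  note this[of "F y" ?n "M + \<mu> / a" ?iw ?nw "F z" ?id ?nd]
  moreover have "a * (a - 1) * F' + a * F' = a\<^sup>2 * F'"
    by (simp add: algebra_simps power2_eq_square)
  moreover have "a\<^sup>2 * ((M - L) / 2) * ?n = a\<^sup>2 * M / 2 * ?n - a\<^sup>2 * L / 2 * ?n"
    by (simp add: diff_divide_distrib algebra_simps)
  moreover have "(l + \<mu> / a) / 2 * ?s = l / 2 * ?s + \<mu> / (2 * a) * ?s"
    by (simp add: add_divide_distrib distrib_right)
  ultimately have "a\<^sup>2 * F' + a\<^sup>2 * ((M - L) / 2) * ?n + (M + \<mu>) / 2 * (norm (z - xh))\<^sup>2
      \<le> a * (a - 1) * F y + a * F z + M / 2 * (norm ((a - 1) *\<^sub>R w + d))\<^sup>2 + (l + \<mu> / a) / 2 * ?s"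
    using sum prox nonneg xh_le unfolding dist by linarith
  moreover have "norm (z - x) = norm ((a - 1) *\<^sub>R w + d)" "norm (y - z) = norm (w - d)"
    by (simp_all add: x y z algebra_simps)
  ultimately show ?thesis
    by (simp add: p_def)
qed

section \<open>Counting iterations\<close>

lemma real_le_powr:
  fixes X :: real
  assumes "real N ^ k \<le> X" "k > 0"
  shows "real N \<le> X powr (1 / real k)"
proof -
  have "real N = (real N ^ k) powr (1 / real k)"
    using assms(2) by (cases "N = 0") (auto simp: powr_realpow[symmetric] powr_powr)
  also have "\<dots> \<le> X powr (1 / real k)"
    using assms(1) by (intro powr_mono2) auto
  finally show ?thesis .
qed

text \<open>Lets a constant \<open>W \<ge> 1\<close> leave the roots in the final bound.\<close>

lemma powr_mult_le:
  fixes W X s :: real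
  assumes "1 \<le> W" "0 \<le> X" "s \<le> 1"
  shows "(W * X) powr s \<le> W * X powr s"
proof -
  have "W powr s \<le> W powr 1"
    using assms by (intro powr_mono) auto
  then show ?thesis
    using assms by (simp add: powr_mult mult_right_mono)
qed

text \<open>One of the three summands on the right of \<open>le\<close> is at least a third of the
  left side. Each case, solved for \<open>N\<close>, gives one term of the bound; the factors are 48
  = 3 * 16 and 12 = 3 * 4.\<close>

lemma iteration_count:
  fixes a :: "nat \<Rightarrow> real"
  assumes q: "q > 0" and e: "e1 \<ge> 0" "e2 \<ge> 0" "e3 \<ge> 0"
    and a: "\<And>k. a k \<ge> (real k + 1) / 2"
    and le: "q * (\<Sum>k<N. (a k)\<^sup>2) \<le> e1 + e2 * (\<Sum>k<N. a k) + e3 * real N"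
  shows "real N \<le> (48 * e1 / q) powr (1 / 3) + (48 * e3 / q) powr (1 / 2) + 12 * e2 / q"
proof (cases "N = 0")
  case True
  then show ?thesis using e q by (auto intro!: add_nonneg_nonneg)
next
  case False
  define S Q where "S = (\<Sum>k<N. a k)" and "Q = (\<Sum>k<N. (a k)\<^sup>2)"
  have "(real N)\<^sup>2 / 4 \<le> (\<Sum>k<N. (real k + 1) / 2)"
    by (induction N) (auto simp: power2_eq_square field_simps)
  also have "\<dots> \<le> S"
    unfolding S_def by (intro sum_mono a)
  finally have S: "(real N)\<^sup>2 / 4 \<le> S" .
  have N: "real N > 0" using False by simp
  have S_pos: "S > 0"
    using S N by (smt (verit) divide_pos_pos zero_less_power)
  \<comment> \<open>Cauchy-Schwarz, \<open>S\<^sup>2 \<le> Q * real N\<close>, together with the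
    quadratic growth of \<open>S\<close>, shows that \<open>Q\<close> exceeds \<open>S\<close> by a
    factor of order \<open>N\<close>.\<close>
  have "S * ((real N)\<^sup>2 / 4) \<le> S\<^sup>2"
    using S S_pos by (simp add: power2_eq_square mult_left_mono)
  also have "\<dots> \<le> Q * real N"
    unfolding S_def Q_def using sum_squared_le_sum_of_squares[of a "{..<N}"] by simp
  finally have "S * real N / 4 * real N \<le> Q * real N"
    by (simp add: power2_eq_square mult_ac)
  then have QS: "S * real N / 4 \<le> Q"
    using N by simp
  have "(real N)^3 / 16 = (real N)\<^sup>2 / 4 * real N / 4"
    by (simp add: power2_eq_square power3_eq_cube)
  also have "\<dots> \<le> S * real N / 4"
    using S N by (intro divide_right_mono mult_right_mono) auto
  finally have QN: "(real N)^3 / 16 \<le> Q"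
    using QS by simp
  have nonneg: "(48 * e1 / q) powr (1 / 3) \<ge> 0" "(48 * e3 / q) powr (1 / 2) \<ge> 0" "12 * e2 / q \<ge> 0"
    using e q by auto
  consider "q * Q \<le> 3 * e1" | "q * Q \<le> 3 * (e2 * S)" | "q * Q \<le> 3 * (e3 * real N)"
    using le unfolding S_def[symmetric] Q_def[symmetric] by linarith
  then show ?thesis
  proof cases
    case 1
    have "q * ((real N)^3 / 16) \<le> q * Q"
      using QN q by simp
    with 1 have "q * real N ^ 3 \<le> 48 * e1"
      by linarith
    then have "real N ^ 3 \<le> 48 * e1 / q"
      using q by (simp add: field_simps)
    from real_le_powr[OF this] have "real N \<le> (48 * e1 / q) powr (1 / 3)" by simp
    with nonneg show ?thesis by linarith
  next
    case 2
    have "q * (S * real N / 4) \<le> q * Q"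
      using QS q by simp
    with 2 have "S * (q * real N) \<le> S * (12 * e2)"
      by (simp add: mult_ac)
    then have "real N \<le> 12 * e2 / q"
      using S_pos q by (simp add: field_simps)
    with nonneg show ?thesis by linarith
  next
    case 3
    have "q * ((real N)^3 / 16) \<le> q * Q"
      using QN q by simp
    with 3 have "real N * (q * (real N)\<^sup>2) \<le> real N * (48 * e3)"
      by (simp add: power2_eq_square power3_eq_cube mult_ac)
    then have "real N ^ 2 \<le> 48 * e3 / q"
      using N q by (simp add: field_simps)
    from real_le_powr[OF this] have "real N \<le> (48 * e3 / q) powr (1 / 2)" by simp
    with nonneg show ?thesis by linarith
  qed
qed


section \<open>Analysis of NC-FISTA\<close>

locale nc_fista_run = nc_fista +
  assumes A1: "assumption_A1 n h" and A2: "assumption_A2 n h"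
    and A3: "assumption_A3 n f h \<Omega>" and A4: "assumption_A4 n f h \<Omega>"
    and input: "nc_fista_input n f h \<Omega> y0 M m A0 \<rho>"
begin

section \<open>Parameters and bounds for the given problem\<close>

abbreviation Mb :: real where "Mb \<equiv> M_bar n f \<Omega>"
abbreviation mb :: real where "mb \<equiv> m_bar n f \<Omega>"
abbreviation D :: "evec set" where "D \<equiv> eff_dom n h"
abbreviation H :: "evec \<Rightarrow> real" where "H z \<equiv> real_of_ereal (h z)"

lemma params: "M > 0" "m > 0" "m \<le> M" "mb \<le> m" "Mb < M" "A0 > 0" "\<rho> > 0" "y0 \<in> D"
  using input by (auto simp: nc_fista_input_def)

lemma Mb_nonneg: "0 \<le> Mb"
  using M_bar_lipschitz[OF A3] by (rule lipschitz_on_nonneg)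

lemmas mb_nonneg = m_bar_curvature(2)[OF A1 A3 A4]

lemma Omega: "closed \<Omega>" "convex \<Omega>" "D \<subseteq> \<Omega>" "\<Omega> \<subseteq> Rn n"
  using A3 by (auto simp: assumption_A3_def)

lemma grad_Omega:
  assumes "z \<in> \<Omega>"
  shows "grad n f z \<in> Rn n"
    "(f has_derivative (\<lambda>w. inner w (grad n f z))) (at z within Rn n)"
  using grad_works[of z n f] A3 assms by (auto simp: assumption_A3_def)

lemma continuous_on_f: "continuous_on \<Omega> f"
  unfolding continuous_on_eq_continuous_within
  using grad_Omega(2) Omega(4) has_derivative_continuous continuous_within_subset by blast

lemma f_upper:
  assumes "z \<in> \<Omega>" "z' \<in> \<Omega>"
  shows "f z' \<le> linearization n f z' z + Mb / 2 * (norm (z' - z))\<^sup>2"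
  unfolding linearization_def
  by (rule descent_lemma[OF Omega(2) assms has_derivative_subset[OF grad_Omega(2) Omega(4)]
        M_bar_lipschitz[OF A3]])

lemma f_lower:
  assumes "z \<in> \<Omega>" "z' \<in> \<Omega>"
  shows "linearization n f z' z \<le> f z' + mb / 2 * (norm (z' - z))\<^sup>2"
  using m_bar_curvature(1)[OF A1 A3 A4] assms by (force simp: lower_curvature_def)

section \<open>Projection onto \<open>\<Omega>\<close>\<close>

lemma proj_in: "proj p \<in> \<Omega>"
  and proj_le: "w \<in> \<Omega> \<Longrightarrow> dist p (proj p) \<le> dist p w"
proof -
  obtain z where "z \<in> \<Omega>" "\<forall>w\<in>\<Omega>. dist p z \<le> dist p w"
    using closest_point_Rn[OF Omega(1) _ Omega(4)] Omega(3) params(8) by blast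
  then show "proj p \<in> \<Omega>" "w \<in> \<Omega> \<Longrightarrow> dist p (proj p) \<le> dist p w"
    unfolding proj_def using arg_min_on_minimizes[of z \<Omega> "dist p"] by blast+
qed

text \<open>The optimality condition of the projection is the obtuse angle condition at
  \<open>?c\<close>. Thus projecting \<open>next_x_hat\<close> onto \<open>\<Omega>\<close> cannot
  increase the distance term of the energy.\<close>

lemma proj_contracts:
  assumes z: "z \<in> \<Omega>"
  shows "norm (z - proj p) \<le> norm (z - p)"
proof -
  let ?c = "proj p"
  have "0 + inner (2 *\<^sub>R (p - ?c) - 0) (z - ?c) \<le> (0::real)"
  proof (rule prox_subgradient[where h = "\<lambda>_. 0" and D = \<Omega>])
    show "convex_on \<Omega> (\<lambda>_. 0::real)"
      using Omega(2) by (simp add: convex_on_def)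
    show "inner 0 ?c + 0 + 2 / 2 * (norm (?c - p))\<^sup>2 \<le> inner 0 w + 0 + 2 / 2 * (norm (w - p))\<^sup>2"
      if "w \<in> \<Omega>" for w
      using proj_le[OF that, of p] by (simp add: dist_norm norm_minus_commute power_mono)
  qed (use proj_in z in auto)
  moreover have "(norm (b - c))\<^sup>2 = (norm b)\<^sup>2 + (norm c)\<^sup>2 - 2 * inner c b" for b c :: evec
    unfolding power2_norm_eq_inner by (simp add: inner_simps inner_commute)
  note this[of "z - ?c" "p - ?c"]
  ultimately have "(norm (z - ?c))\<^sup>2 + (norm (p - ?c))\<^sup>2 \<le> (norm (z - p))\<^sup>2"
    by simp
  then have "(norm (z - ?c))\<^sup>2 \<le> (norm (z - p))\<^sup>2"
    using zero_le_power2[of "norm (p - ?c)"] by linarith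
  then show ?thesis
    by (rule power2_le_imp_le) simp
qed

section \<open>The sequences \<open>A\<close> and \<open>a\<close>, and the choice of
  \<open>kappa0\<close>\<close>

lemma A_pos: "A k > 0"
  using params by (induction k) (auto intro!: add_pos_nonneg)

lemma a_gt_1: "a k > 1"
  unfolding a_def using A_pos[of k] real_sqrt_gt_1_iff[of "1 + 4 * A k"] by simp

text \<open>\<open>a k\<close> is the positive root of \<open>t\<^sup>2 - t = A k\<close>.\<close>

lemma a_sq: "(a k)\<^sup>2 = A (Suc k)"
  using A_pos[of k] by (simp add: a_def power2_eq_square field_simps)

lemma A_Suc: "A (Suc k) = A k + a k"
  by (simp add: a_def)

lemma A_eq: "A k = a k * (a k - 1)"
  using a_sq[of k] unfolding A_Suc by (simp add: power2_eq_square algebra_simps)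

lemma a_Suc: "a k + 1 / 2 \<le> a (Suc k)"
proof -
  have "2 * a k \<le> sqrt (1 + 4 * A (Suc k))"
    unfolding a_sq[symmetric] by (rule real_le_rsqrt) (simp add: power_mult_distrib)
  then show ?thesis
    unfolding a_def[of "Suc k"] by (simp add: field_simps del: A.simps)
qed

lemma a_ge: "a k \<ge> (real k + 1) / 2"
proof (induction k)
  case 0
  then show ?case using a_gt_1[of 0] by simp
next
  case (Suc k)
  then show ?case using a_Suc[of k] by simp
qed

lemma a_ge_a0: "a 0 \<le> a k"
proof (induction k)
  case (Suc k)
  then show ?case using a_Suc[of k] by simp
qed simp

lemma kappa0_eq: "kappa0 = a 0 / (a 0 - 1)"
  using a_gt_1[of 0] by (simp add: kappa0_def a_def field_simps)

lemma kappa0_pos: "kappa0 > 0"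
  unfolding kappa0_eq using a_gt_1[of 0] by simp

text \<open>\<open>t / (t - 1)\<close> decreases for \<open>t > 1\<close>, so the first index is the
  worst one, and there \<open>kappa0\<close> gives equality.\<close>

lemma kappa0_ge: "a k \<le> kappa0 * (a k - 1)"
  unfolding kappa0_eq using a_ge_a0[of k] a_gt_1[of 0] by (simp add: field_simps)

lemma prox_coeff_eq: "prox_coeff k = M + kappa0 * m / a k"
  by (simp add: prox_coeff_def lam_def)

lemma prox_coeff_pos: "prox_coeff k > 0"
  unfolding prox_coeff_eq using params a_gt_1[of k] kappa0_pos by (intro add_pos_pos) auto

section \<open>The proximal subproblem\<close>

lemma next_y_minimizes:
  defines "F k xt u \<equiv> ereal (linearization n f u xt) + h u
    + ereal (1 / 2 * prox_coeff k * (norm (u - xt))\<^sup>2)"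
  shows "next_y k xt \<in> D" "u \<in> Rn n \<Longrightarrow> F k xt (next_y k xt) \<le> F k xt u"
proof -
  let ?q = "\<lambda>u. linearization n f u xt + 1 / 2 * prox_coeff k * (norm (u - xt))\<^sup>2"
  have F: "F k xt u = ereal (?q u) + h u" for u
    unfolding F_def by (cases "h u") auto
  have "continuous_on (Rn n) ?q"
    unfolding linearization_def by (intro continuous_intros)
  then obtain z where z: "z \<in> D" "\<forall>u\<in>Rn n. F k xt z \<le> F k xt u"
    using composite_attains_min[OF A1 A2 closed_Rn[of n], where q = ?q] F by (auto simp: eff_dom_def)
  then have "z \<in> Rn n" by (auto simp: eff_dom_def)
  note min = arg_min_on_minimizes[of z "Rn n" "F k xt", OF \<open>z \<in> Rn n\<close>]
  have next_y: "next_y k xt = arg_min_on (F k xt) (Rn n)"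
    unfolding next_y_def F_def ..
  show 1: "u \<in> Rn n \<Longrightarrow> F k xt (next_y k xt) \<le> F k xt u" for u
    unfolding next_y using min(2) z(2) by blast
  have R: "next_y k xt \<in> Rn n"
    unfolding next_y using min(1) z(2) by blast
  have "F k xt (next_y k xt) \<le> F k xt z"
    using 1 \<open>z \<in> Rn n\<close> .
  also have "\<dots> < \<infinity>"
    using z(1) by (auto simp: F eff_dom_def)
  finally show "next_y k xt \<in> D"
    using R by (auto simp: F eff_dom_def)
qed

text \<open>This subgradient of \<open>h\<close> serves twice: with the gradient at the new point it
  forms the residual, and tested at \<open>y k\<close> and at a solution it yields the energy
  decrease.\<close>

lemma next_y_subgradient:
  assumes "u \<in> D"
  shows "H (next_y k xt) + inner (prox_coeff k *\<^sub>R (xt - next_y k xt) - grad n f xt) (u - next_y k xt)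
    \<le> H u"
proof (rule prox_subgradient[OF convex_ext_real(1)[OF A1] next_y_minimizes(1) assms])
  fix w assume w: "w \<in> D"
  let ?p = "next_y k xt"
  have "ereal (linearization n f ?p xt) + ereal (H ?p) + ereal (1 / 2 * prox_coeff k * (norm (?p - xt))\<^sup>2)
      \<le> ereal (linearization n f w xt) + ereal (H w) + ereal (1 / 2 * prox_coeff k * (norm (w - xt))\<^sup>2)"
    unfolding ereal_h[OF A1 w] ereal_h[OF A1 next_y_minimizes(1)]
    using w by (intro next_y_minimizes(2)) (auto simp: eff_dom_def)
  then show "inner (grad n f xt) ?p + H ?p + prox_coeff k / 2 * (norm (?p - xt))\<^sup>2
      \<le> inner (grad n f xt) w + H w + prox_coeff k / 2 * (norm (w - xt))\<^sup>2"
    by (simp add: linearization_def inner_diff_right)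
qed

section \<open>The iterates and the residuals\<close>

lemma y_0: "y 0 = y0" and x_0: "x 0 = y0"
  by (simp_all add: y_def x_def)

lemma y_Suc: "y (Suc k) = next_y k (x_tilde k)"
  and x_Suc: "x (Suc k) = proj (next_x_hat k (y k) (y (Suc k)))"
  by (simp_all add: y_def x_def x_tilde_def Let_def split_beta)

lemma y_in: "y k \<in> D"
  by (cases k) (simp_all add: y_0 y_Suc params next_y_minimizes(1))

lemma x_in: "x k \<in> \<Omega>"
  using params(8) Omega(3) by (cases k) (auto simp: x_0 x_Suc proj_in)

lemma x_tilde_eq: "a k *\<^sub>R x_tilde k = (a k - 1) *\<^sub>R y k + x k"
proof -
  have "a k * (A k / A (Suc k)) = a k - 1" "a k * (a k / A (Suc k)) = 1"
    unfolding a_sq[symmetric] A_eq[of k] using a_gt_1[of k]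
    by (simp_all add: power2_eq_square)
  then show ?thesis
    by (simp only: x_tilde_def extrapolate_def scaleR_right_distrib scaleR_scaleR scaleR_one)
qed

lemma x_tilde_in: "x_tilde k \<in> \<Omega>"
  unfolding x_tilde_def extrapolate_def
proof (rule convexD[OF Omega(2)])
  show "A k / A (Suc k) + a k / A (Suc k) = 1"
    using A_pos[of "Suc k"] unfolding add_divide_distrib[symmetric] A_Suc[symmetric] by simp
qed (use A_pos[of k] A_pos[of "Suc k"] a_gt_1[of k] y_in Omega(3) x_in in \<open>auto simp del: A.simps\<close>)

text \<open>Clearing denominators with \<open>lam = 1 / M\<close> gives the form required by
  \<open>accelerated_step\<close> for \<open>\<mu> = kappa0 * m\<close>.\<close>

lemma next_x_hat_eq:
  "(M + kappa0 * m) *\<^sub>R next_x_hat k (y k) (y (Suc k))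
    = (M * a k + kappa0 * m) *\<^sub>R y (Suc k) - (M * (a k - 1)) *\<^sub>R y k"
proof -
  let ?s = "kappa0 * m * lam + 1"
  have "?s \<noteq> 0"
    using params kappa0_pos by (simp add: lam_def add_nonneg_eq_0_iff)
  then have "(M * ?s) *\<^sub>R next_x_hat k (y k) (y (Suc k))
      = M *\<^sub>R ((a k + kappa0 * m * lam) *\<^sub>R y (Suc k) - (a k - 1) *\<^sub>R y k)"
    by (simp add: next_x_hat_def)
  moreover have "M * ?s = M + kappa0 * m" "M * (a k + kappa0 * m * lam) = M * a k + kappa0 * m"
    using params(1) by (simp_all add: lam_def field_simps)
  ultimately show ?thesis
    by (simp add: scaleR_diff_right)
qed

text \<open>Without the gradient at \<open>y (Suc k)\<close>, the residual is the proximal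
  subgradient \<open>?g\<close>. Outside the domain the subgradient inequality is trivial.\<close>

lemma v_next_approx:
  assumes "norm (v_next k) \<le> \<rho>"
  shows "approx_solution n f h \<rho> (y (Suc k)) (v_next k)"
proof -
  let ?g = "prox_coeff k *\<^sub>R (x_tilde k - y (Suc k)) - grad n f (x_tilde k)"
  have R: "y (Suc k) \<in> Rn n" "x_tilde k \<in> Rn n" "grad n f (x_tilde k) \<in> Rn n"
    using y_in Omega(3,4) x_tilde_in grad_Omega(1) by blast+
  have "h (y (Suc k)) + ereal (inner ?g (u - y (Suc k))) \<le> h u" if u: "u \<in> Rn n" for u
  proof (cases "u \<in> D")
    case True
    then have "ereal (H (y (Suc k))) + ereal (inner ?g (u - y (Suc k))) \<le> ereal (H u)"
      using next_y_subgradient[OF True, of k "x_tilde k"] by (simp add: y_Suc)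
    then show ?thesis
      by (simp only: ereal_h[OF A1 True] ereal_h[OF A1 y_in])
  next
    case False
    then show ?thesis using u by (simp add: eff_dom_def)
  qed
  then have "?g \<in> subdifferential n h (y (Suc k))"
    using R by (auto simp: subdifferential_def intro!: Rn_intros)
  moreover have "v_next k = grad n f (y (Suc k)) + ?g"
    by (simp add: v_next_def algebra_simps)
  ultimately show ?thesis
    using assms R by (auto simp: approx_solution_def)
qed

text \<open>Conversely, a residual above the tolerance forces a long step, which is what consumes
  energy.\<close>

lemma norm_v_next_le: "norm (v_next k) \<le> (2 + kappa0) * M * norm (y (Suc k) - x_tilde k)"
proof -
  let ?p = "norm (y (Suc k) - x_tilde k)"
  have "norm (v_next k) \<le> norm (prox_coeff k *\<^sub>R (x_tilde k - y (Suc k)))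
      + norm (grad n f (y (Suc k)) - grad n f (x_tilde k))"
    unfolding v_next_def add_diff_eq[symmetric] by (rule norm_triangle_ineq)
  also have "norm (prox_coeff k *\<^sub>R (x_tilde k - y (Suc k))) = prox_coeff k * ?p"
    using prox_coeff_pos[of k] by (simp add: norm_minus_commute)
  also have "norm (grad n f (y (Suc k)) - grad n f (x_tilde k)) \<le> Mb * ?p"
    using lipschitz_onD[OF M_bar_lipschitz[OF A3], of "y (Suc k)" "x_tilde k"]
      y_in Omega(3) x_tilde_in by (auto simp: dist_norm)
  also have "prox_coeff k * ?p + Mb * ?p = (prox_coeff k + Mb) * ?p"
    by (simp add: distrib_right)
  also have "\<dots> \<le> (2 + kappa0) * M * ?p"
  proof (rule mult_right_mono)
    have "kappa0 * m / a k \<le> kappa0 * m / 1"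
      using a_gt_1[of k] kappa0_pos params by (intro divide_left_mono) auto
    also have "\<dots> \<le> kappa0 * M"
      using params kappa0_pos by simp
    finally show "prox_coeff k + Mb \<le> (2 + kappa0) * M"
      using params by (simp add: prox_coeff_eq distrib_right)
  qed simp
  finally show ?thesis by simp
qed

section \<open>Energy decrease\<close>

definition energy :: "evec \<Rightarrow> nat \<Rightarrow> real" where
  "energy z k = A k * (f (y k) + H (y k) - (f z + H z))
    + (M + kappa0 * m) / 2 * (norm (z - x k))\<^sup>2"

text \<open>\<open>accelerated_step\<close> with \<open>L = Mb\<close>, \<open>l = mb\<close>,
  \<open>\<mu> = kappa0 * m\<close>. Its error in \<open>norm (y k - z)\<close> is bounded by the
  diameter; the one in \<open>norm (z - x k)\<close>, where \<open>x k\<close> may lie outside the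
  domain, is absorbed.\<close>

lemma energy_step:
  assumes z: "z \<in> D"
  shows "energy z (Suc k) + (a k)\<^sup>2 * ((M - Mb) / 2 * (norm (y (Suc k) - x_tilde k))\<^sup>2)
    \<le> energy z k + (mb * a k + kappa0 * m) / 2 * (diameter D)\<^sup>2"
proof -
  let ?\<mu> = "kappa0 * m" and ?y' = "y (Suc k)" and ?xt = "x_tilde k"
  let ?xh = "next_x_hat k (y k) ?y'" and ?\<phi> = "\<lambda>u. f u + H u"
  have \<mu>: "?\<mu> \<ge> 0" using kappa0_pos params by simp
  have y'_in: "?y' \<in> \<Omega>" using y_in Omega(3) by blast
  \<comment> \<open>Adds the proximal optimality condition, the upper bound on \<open>f\<close> at
    \<open>?y'\<close> and the lower bound on \<open>f\<close> at \<open>u\<close>.\<close>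
  have "?\<phi> ?y' \<le> ?\<phi> u + Mb / 2 * (norm (?y' - ?xt))\<^sup>2
      + (M + ?\<mu> / a k) * inner (?y' - ?xt) (u - ?y') + mb / 2 * (norm (u - ?xt))\<^sup>2"
    if "u \<in> {y k, z}" for u
  proof -
    have u: "u \<in> D" "u \<in> \<Omega>" using that z y_in Omega(3) by auto
    have "inner (prox_coeff k *\<^sub>R (?xt - ?y') - grad n f ?xt) (u - ?y')
        = linearization n f ?y' ?xt - linearization n f u ?xt
          - prox_coeff k * inner (?y' - ?xt) (u - ?y')"
      by (simp add: linearization_def inner_diff_left inner_diff_right algebra_simps)
    then show ?thesis
      using next_y_subgradient[OF u(1), of k ?xt] f_upper[OF x_tilde_in y'_in, of k]
        f_lower[OF x_tilde_in u(2), of k]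
      unfolding y_Suc[symmetric] prox_coeff_eq by linarith
  qed
  from accelerated_step[OF a_gt_1 \<mu> params(1) x_tilde_eq next_x_hat_eq this]
  have step: "(a k)\<^sup>2 * ?\<phi> ?y' + (a k)\<^sup>2 * ((M - Mb) / 2) * (norm (?y' - ?xt))\<^sup>2
      + (M + ?\<mu>) / 2 * (norm (z - ?xh))\<^sup>2
    \<le> a k * (a k - 1) * ?\<phi> (y k) + a k * ?\<phi> z + M / 2 * (norm (z - x k))\<^sup>2
      + (mb + ?\<mu> / a k) / 2 * ((a k - 1) * (norm (y k - z))\<^sup>2 + (norm (z - x k))\<^sup>2)" .
  have "norm (y k - z) \<le> diameter D"
    using diameter_bounded_bound[of D "y k" z] A2 y_in z by (auto simp: assumption_A2_def dist_norm)
  then have "(norm (y k - z))\<^sup>2 \<le> (diameter D)\<^sup>2"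
    by (simp add: power_mono)
  then have "(a k - 1) * (norm (y k - z))\<^sup>2 \<le> a k * (diameter D)\<^sup>2"
    using a_gt_1[of k] by (intro mult_mono) auto
  then have "(mb + ?\<mu> / a k) / 2 * ((a k - 1) * (norm (y k - z))\<^sup>2)
      \<le> (mb + ?\<mu> / a k) / 2 * (a k * (diameter D)\<^sup>2)"
    using mb_nonneg \<mu> a_gt_1[of k] by (intro mult_left_mono) auto
  also have "\<dots> = (mb * a k + ?\<mu>) / 2 * (diameter D)\<^sup>2"
    using a_gt_1[of k] by (simp add: field_simps)
  finally have err: "(mb + ?\<mu> / a k) / 2 * ((a k - 1) * (norm (y k - z))\<^sup>2) \<le> \<dots>" .
  \<comment> \<open>The purpose of \<open>kappa0\<close>: the growth \<open>?\<mu>\<close> of the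
    distance weight pays for \<open>mb + ?\<mu> / a k\<close>, as \<open>mb \<le> m\<close>.\<close>
  have "m * a k \<le> m * (kappa0 * (a k - 1))"
    using kappa0_ge[of k] params by simp
  then have "m + ?\<mu> / a k \<le> ?\<mu>"
    using a_gt_1[of k] by (simp add: field_simps)
  then have "(M + (mb + ?\<mu> / a k)) / 2 * (norm (z - x k))\<^sup>2 \<le> (M + ?\<mu>) / 2 * (norm (z - x k))\<^sup>2"
    using params(4) by (intro mult_right_mono divide_right_mono) auto
  then have gain: "M / 2 * (norm (z - x k))\<^sup>2 + (mb + ?\<mu> / a k) / 2 * (norm (z - x k))\<^sup>2
      \<le> (M + ?\<mu>) / 2 * (norm (z - x k))\<^sup>2"
    by (simp only: add_divide_distrib distrib_right)
  have "norm (z - x (Suc k)) \<le> norm (z - ?xh)"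
    unfolding x_Suc using z Omega(3) by (intro proj_contracts) blast
  then have "(norm (z - x (Suc k)))\<^sup>2 \<le> (norm (z - ?xh))\<^sup>2"
    by (simp add: power_mono)
  then have proj: "(M + ?\<mu>) / 2 * (norm (z - x (Suc k)))\<^sup>2 \<le> (M + ?\<mu>) / 2 * (norm (z - ?xh))\<^sup>2"
    using params \<mu> by (intro mult_left_mono) auto
  \<comment> \<open>Subtracting \<open>(a k)\<^sup>2 * ?\<phi> z\<close> turns the function values
    into gaps to \<open>?\<phi> z\<close>.\<close>
  have "a k * (a k - 1) * ?\<phi> (y k) + a k * ?\<phi> z - (a k)\<^sup>2 * ?\<phi> z
      = a k * (a k - 1) * (?\<phi> (y k) - ?\<phi> z)"
    by (simp add: power2_eq_square algebra_simps)
  with step err gain proj show ?thesis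
    unfolding energy_def a_sq[symmetric] A_eq[of k] distrib_left right_diff_distrib mult.assoc
    by linarith
qed

lemma energy_sum:
  assumes z: "z \<in> D"
  shows "energy z N + (\<Sum>k<N. (a k)\<^sup>2 * ((M - Mb) / 2 * (norm (y (Suc k) - x_tilde k))\<^sup>2))
    \<le> energy z 0 + mb * (diameter D)\<^sup>2 / 2 * (\<Sum>k<N. a k) + kappa0 * m * (diameter D)\<^sup>2 / 2 * real N"
proof (induction N)
  case (Suc N)
  then show ?case
    using energy_step[OF z, of N] by (simp add: field_simps)
qed simp

section \<open>Bounding the number of unsuccessful iterations\<close>

text \<open>Every unsuccessful iteration \<open>k\<close> consumes at least
  \<open>q * (a k)\<^sup>2\<close> of energy, and the final energy is nonnegative, so
  \<open>iteration_count\<close> applies. \<open>W\<close> depends only on the bounds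
  \<open>C\<close>, \<open>c2\<close>, \<open>\<kappa>\<close>.\<close>

lemma iterations_le:
  fixes C c2 \<kappa> :: real
  defines "W \<equiv> 96 * C * (2 + \<kappa>)\<^sup>2 * (c2 + 1 + \<kappa>)"
  assumes \<kappa>: "kappa0 \<le> \<kappa>" and C: "M / (M - Mb) \<le> C" and c2: "A0 \<le> c2"
    and running: "\<And>k. k < N \<Longrightarrow> \<rho> < norm (v_next k)"
  shows "real N \<le> W *
    (((M * real_of_ereal (phi f h y0 - phi_star n f h)
       + M\<^sup>2 * (infdist y0 (optimal_set n f h))\<^sup>2) / \<rho>\<^sup>2) powr (1 / 3)
     + (M * m * (diameter D)\<^sup>2 / \<rho>\<^sup>2) powr (1 / 2)
     + M * mb * (diameter D)\<^sup>2 / \<rho>\<^sup>2)"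
proof -
  obtain z where z: "z \<in> D" "z \<in> optimal_set n f h"
    and dz: "dist y0 z = infdist y0 (optimal_set n f h)"
    using optimal_set_closest[OF A1 A2 Omega(1,3,4) continuous_on_f] by blast
  have phi_eq: "phi f h u = ereal (f u + H u)" if "u \<in> D" for u
    using ereal_h[OF A1 that] by (metis phi_def plus_ereal.simps(1))
  have star: "phi_star n f h = ereal (f z + H z)"
    using z phi_eq by (auto simp: optimal_set_def)
  have opt: "f z + H z \<le> f u + H u" if "u \<in> D" for u
  proof -
    have "phi_star n f h \<le> phi f h u"
      unfolding phi_star_def using that by (intro INF_lower) (auto simp: eff_dom_def)
    then show ?thesis by (simp add: star phi_eq that)
  qed
  define \<Delta> d where "\<Delta> = f y0 + H y0 - (f z + H z)" and "d = norm (z - y0)"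
  \<comment> \<open>Both values are finite, so \<open>real_of_ereal\<close> returns the true
    gap.\<close>
  have \<Delta>: "real_of_ereal (phi f h y0 - phi_star n f h) = \<Delta>" "\<Delta> \<ge> 0"
    using opt params(8) by (simp_all add: star phi_eq \<Delta>_def)
  have d: "infdist y0 (optimal_set n f h) = d"
    using dz by (simp add: d_def dist_norm norm_minus_commute)
  have gap: "M - Mb > 0" using params by simp
  have "1 \<le> M / (M - Mb)"
    using gap Mb_nonneg by simp
  then have C1: "1 \<le> C" using C by simp
  have \<kappa>0: "\<kappa> > 0" using kappa0_pos \<kappa> by simp
  have c20: "c2 > 0" using params c2 by simp
  \<comment> \<open>Combines the step length, at least \<open>\<rho> / ((2 + \<kappa>) * M)\<close>,
    with \<open>M - Mb \<ge> M / C\<close>.\<close>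
  define q where "q = \<rho>\<^sup>2 / (2 * C * (2 + \<kappa>)\<^sup>2 * M)"
  have q: "q > 0"
    unfolding q_def using params C1 \<kappa>0 by simp
  have q_le: "q \<le> (M - Mb) / 2 * (norm (y (Suc k) - x_tilde k))\<^sup>2" if "k < N" for k
  proof -
    let ?p = "norm (y (Suc k) - x_tilde k)"
    have "\<rho> \<le> (2 + kappa0) * M * ?p"
      using running[OF that] norm_v_next_le[of k] by simp
    also have "\<dots> \<le> (2 + \<kappa>) * M * ?p"
      using \<kappa> params by (intro mult_right_mono) auto
    finally have "\<rho>\<^sup>2 \<le> ((2 + \<kappa>) * M * ?p)\<^sup>2"
      using params by (intro power_mono) auto
    then have "q \<le> ((2 + \<kappa>) * M * ?p)\<^sup>2 / (2 * C * (2 + \<kappa>)\<^sup>2 * M)"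
      unfolding q_def using params C1 by (intro divide_right_mono) auto
    also have "\<dots> = M / C / 2 * ?p\<^sup>2"
    proof -
      have "(c * M * ?p)\<^sup>2 / (2 * C * c\<^sup>2 * M) = M / C / 2 * ?p\<^sup>2" if "c \<noteq> 0" for c
        using that params(1) C1 by (simp add: power_mult_distrib field_simps power2_eq_square)
      then show ?thesis using \<kappa>0 by simp
    qed
    also have "\<dots> \<le> (M - Mb) / 2 * ?p\<^sup>2"
      using C gap C1 by (intro mult_right_mono divide_right_mono) (auto simp: field_simps)
    finally show ?thesis .
  qed
  define e1 e2 e3 where "e1 = (c2 + 1 + \<kappa>) * (\<Delta> + M * d\<^sup>2)"
    and "e2 = mb * (diameter D)\<^sup>2 / 2" and "e3 = \<kappa> * m * (diameter D)\<^sup>2 / 2"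
  have "energy z 0 = A0 * \<Delta> + (M + kappa0 * m) / 2 * d\<^sup>2"
    by (simp add: energy_def y_0 x_0 \<Delta>_def d_def)
  also have "\<dots> \<le> (c2 + 1 + \<kappa>) * \<Delta> + (c2 + 1 + \<kappa>) * M * d\<^sup>2"
  proof (intro add_mono mult_right_mono)
    have "kappa0 * m \<le> \<kappa> * M"
      using \<kappa> params kappa0_pos by (intro mult_mono) auto
    moreover have "0 \<le> c2 * M" "0 \<le> \<kappa> * M"
      using c20 \<kappa>0 params by simp_all
    ultimately have "M + kappa0 * m \<le> 2 * (c2 * M) + 2 * M + 2 * (\<kappa> * M)"
      using params(1) by linarith
    then show "(M + kappa0 * m) / 2 \<le> (c2 + 1 + \<kappa>) * M"
      by (simp add: distrib_right)
  qed (use c2 \<kappa>0 \<Delta> in auto)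
  also have "\<dots> = e1"
    by (simp add: e1_def distrib_left mult.assoc)
  finally have E0: "energy z 0 \<le> e1" .
  have EN: "0 \<le> energy z N"
    unfolding energy_def using A_pos[of N] opt[OF y_in] params kappa0_pos
    by (intro add_nonneg_nonneg mult_nonneg_nonneg) auto
  have "kappa0 * m * (diameter D)\<^sup>2 / 2 * real N \<le> e3 * real N"
    unfolding e3_def using \<kappa> params by (intro mult_right_mono divide_right_mono) auto
  moreover have "q * (\<Sum>k<N. (a k)\<^sup>2)
      \<le> (\<Sum>k<N. (a k)\<^sup>2 * ((M - Mb) / 2 * (norm (y (Suc k) - x_tilde k))\<^sup>2))"
    unfolding sum_distrib_left using q_le
    by (intro sum_mono) (simp only: mult.commute[of q] lessThan_iff mult_left_mono zero_le_power2)
  ultimately have "q * (\<Sum>k<N. (a k)\<^sup>2) \<le> e1 + e2 * (\<Sum>k<N. a k) + e3 * real N"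
    using energy_sum[OF z(1), of N] EN E0 unfolding e2_def by linarith
  moreover have "e1 \<ge> 0" "e2 \<ge> 0" "e3 \<ge> 0"
    using c20 \<kappa>0 \<Delta> params mb_nonneg by (simp_all add: e1_def e2_def e3_def)
  ultimately have N: "real N \<le> (48 * e1 / q) powr (1 / 3) + (48 * e3 / q) powr (1 / 2) + 12 * e2 / q"
    using iteration_count[OF q _ _ _ a_ge] by blast
  define X Y Z where "X = (M * \<Delta> + M\<^sup>2 * d\<^sup>2) / \<rho>\<^sup>2" and "Y = M * m * (diameter D)\<^sup>2 / \<rho>\<^sup>2"
    and "Z = M * mb * (diameter D)\<^sup>2 / \<rho>\<^sup>2"
  have nonneg: "X \<ge> 0" "Y \<ge> 0" "Z \<ge> 0"
    using \<Delta> params mb_nonneg by (simp_all add: X_def Y_def Z_def)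
  define B where "B = C * (2 + \<kappa>)\<^sup>2"
  have "1 * 1 \<le> C * (2 + \<kappa>)\<^sup>2"
    using C1 \<kappa>0 by (intro mult_mono one_le_power) auto
  then have B1: "1 \<le> B" by (simp add: B_def)
  \<comment> \<open>The 96 is 48 from \<open>iteration_count\<close> times the 2 in
    \<open>q\<close>; it makes \<open>48 * e1 / q\<close> exactly \<open>W * X\<close>, while the
    other two constants are smaller.\<close>
  have W: "W = 96 * (B * c2) + 96 * B + 96 * (B * \<kappa>)"
    by (simp add: W_def B_def algebra_simps)
  have "0 \<le> B * c2" "0 \<le> B * \<kappa>" using B1 c20 \<kappa>0 by simp_all
  then have W_ge: "1 \<le> W" "48 * B * \<kappa> \<le> W" "12 * B \<le> W"
    using B1 unfolding W mult.assoc by linarith+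
  have inv_q: "t / q = t * (2 * B * M / \<rho>\<^sup>2)" for t
    by (simp add: q_def B_def)
  have "48 * e1 / q = W * X"
    unfolding inv_q W e1_def X_def by (simp add: field_simps power2_eq_square)
  then have 1: "(48 * e1 / q) powr (1 / 3) \<le> W * X powr (1 / 3)"
    using powr_mult_le[OF W_ge(1) nonneg(1)] by simp
  have "48 * e3 / q = 48 * B * \<kappa> * Y"
    unfolding inv_q e3_def Y_def by (simp add: mult_ac)
  also have "\<dots> \<le> W * Y"
    using W_ge(2) nonneg(2) by (rule mult_right_mono)
  finally have "(48 * e3 / q) powr (1 / 2) \<le> (W * Y) powr (1 / 2)"
    using \<open>e3 \<ge> 0\<close> q by (intro powr_mono2) auto
  also have "\<dots> \<le> W * Y powr (1 / 2)"
    using powr_mult_le[OF W_ge(1) nonneg(2)] by simp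
  finally have 2: "(48 * e3 / q) powr (1 / 2) \<le> W * Y powr (1 / 2)" .
  have "12 * e2 / q = 12 * B * Z"
    unfolding inv_q e2_def Z_def by (simp add: mult_ac)
  also have "\<dots> \<le> W * Z"
    using W_ge(3) nonneg(3) by (rule mult_right_mono)
  finally have "real N \<le> W * (X powr (1 / 3) + Y powr (1 / 2) + Z)"
    using N 1 2 unfolding distrib_left by linarith
  then show ?thesis
    unfolding \<Delta>(1) d X_def Y_def Z_def .
qed

text \<open>\<open>(1 + s) / (s - 1)\<close> decreases for \<open>s > 1\<close>. Through this bound
  the lower bound on \<open>A0\<close> enters the complexity constant.\<close>

lemma kappa0_le:
  assumes "0 < c1" "c1 \<le> A0"
  shows "kappa0 \<le> (1 + sqrt (1 + 4 * c1)) / (sqrt (1 + 4 * c1) - 1)"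
proof -
  have "1 < sqrt (1 + 4 * c1)" "sqrt (1 + 4 * c1) \<le> sqrt (1 + 4 * A0)"
    using assms by simp_all
  then show ?thesis
    unfolding kappa0_def by (simp add: field_simps)
qed

end

theorem theorem2p6:
  fixes C c1 c2 :: real
  assumes "0 < c1"
  shows "\<exists>K>0. \<forall>n f h \<Omega> y0 M m A0 \<rho>.
    assumption_A1 n h \<and> assumption_A2 n h \<and> assumption_A3 n f h \<Omega> \<and> assumption_A4 n f h \<Omega> \<and>
    nc_fista_input n f h \<Omega> y0 M m A0 \<rho> \<and>
    M / (M - M_bar n f \<Omega>) \<le> C \<and> c1 \<le> A0 \<and> A0 \<le> c2 \<longrightarrow>
    (\<exists>N y_hat v_hat.
      nc_fista.outputs n f h \<Omega> y0 M m A0 \<rho> N y_hat v_hat \<and>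
      approx_solution n f h \<rho> y_hat v_hat \<and>
      real N \<le> K *
        (((M * real_of_ereal (phi f h y0 - phi_star n f h)
             + M\<^sup>2 * (infdist y0 (optimal_set n f h))\<^sup>2) / \<rho>\<^sup>2) powr (1 / 3)
         + (M * m * (diameter (eff_dom n h))\<^sup>2 / \<rho>\<^sup>2) powr (1 / 2)
         + M * m_bar n f \<Omega> * (diameter (eff_dom n h))\<^sup>2 / \<rho>\<^sup>2
         + 1))"
proof -
  define \<kappa> where "\<kappa> = (1 + sqrt (1 + 4 * c1)) / (sqrt (1 + 4 * c1) - 1)"
  define W where "W = 96 * C * (2 + \<kappa>)\<^sup>2 * (c2 + 1 + \<kappa>)"
  show ?thesis
  \<comment> \<open>\<open>C\<close> and \<open>c2\<close> are arbitrary, so \<open>W\<close> may be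
    negative; the absolute value and the added 1 make the witness positive.\<close>
  proof (intro exI[of _ "\<bar>W\<bar> + 1"] conjI allI impI)
    fix n f h \<Omega> y0 M m A0 \<rho>
    assume *: "assumption_A1 n h \<and> assumption_A2 n h \<and> assumption_A3 n f h \<Omega> \<and>
      assumption_A4 n f h \<Omega> \<and> nc_fista_input n f h \<Omega> y0 M m A0 \<rho> \<and>
      M / (M - M_bar n f \<Omega>) \<le> C \<and> c1 \<le> A0 \<and> A0 \<le> c2"
    interpret nc_fista_run n f h \<Omega> y0 M m A0 \<rho>
      by unfold_locales (use * in auto)
    let ?R = "((M * real_of_ereal (phi f h y0 - phi_star n f h)
             + M\<^sup>2 * (infdist y0 (optimal_set n f h))\<^sup>2) / \<rho>\<^sup>2) powr (1 / 3)
         + (M * m * (diameter (eff_dom n h))\<^sup>2 / \<rho>\<^sup>2) powr (1 / 2)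
         + M * m_bar n f \<Omega> * (diameter (eff_dom n h))\<^sup>2 / \<rho>\<^sup>2"
    have R: "?R \<ge> 0"
      using params mb_nonneg by (intro add_nonneg_nonneg) auto
    have "kappa0 \<le> \<kappa>"
      unfolding \<kappa>_def using assms * by (intro kappa0_le) auto
    then have bound: "real N \<le> W * ?R" if "\<And>k. k < N \<Longrightarrow> \<rho> < norm (v_next k)" for N
      unfolding W_def using * that by (intro iterations_le) auto
    \<comment> \<open>Termination: more than \<open>W * ?R\<close> consecutive failures are
      impossible.\<close>
    obtain N where "W * ?R < real N"
      using reals_Archimedean2 by blast
    then have "\<exists>k. norm (v_next k) \<le> \<rho>"
      using bound[of N] by (meson not_le)
    then obtain k where k: "norm (v_next k) \<le> \<rho>" "\<And>j. j < k \<Longrightarrow> \<rho> < norm (v_next j)"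
      using exists_least_iff[of "\<lambda>k. norm (v_next k) \<le> \<rho>"] by (auto simp: not_le)
    \<comment> \<open>The first \<open>k\<close> iterations fail and the next one stops, hence the
      extra 1.\<close>
    have "real (Suc k) \<le> W * ?R + 1"
      using bound[of k] k(2) by simp
    also have "W * ?R \<le> \<bar>W\<bar> * ?R"
      using R by (intro mult_right_mono) auto
    also have "\<bar>W\<bar> * r + 1 \<le> (\<bar>W\<bar> + 1) * (r + 1)" if "r \<ge> 0" for r
      using that by (simp add: algebra_simps)
    note this[OF R]
    finally have "real (Suc k) \<le> (\<bar>W\<bar> + 1) * (?R + 1)"
      by simp
    moreover have "outputs (Suc k) (y (Suc k)) (v_next k)"
      unfolding outputs_def using k by blast
    ultimately show "\<exists>N y_hat v_hat. outputs N y_hat v_hat \<and> approx_solution n f h \<rho> y_hat v_hat \<and>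
      real N \<le> (\<bar>W\<bar> + 1) * (?R + 1)"
      using v_next_approx[OF k(1)] by blast
  qed simp
qed

end
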